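(* Let $R$ be a ring and let $M$ be a left $R$-module which is a progenerator in $\sigma[M]$. Suppose $M$ is co-semisimple and a Goldie module. If $E$ is an indecomposable injective module in $\sigma[M]$ such that $E$ embeds in $\widehat{M}$, then $E$ is $FI$-simple.
   Context: Rings are associative with unit and modules are left unital modules. $\sigma[M]$ is the full subcategory of $R$-Mod of $M$-subgenerated modules (submodules of quotients of direct sums of copies of $M$). "Projective in $\sigma[M]$" means that $\mathrm{Hom}_R(M,-)$ is exact on short exact sequences in $\sigma[M]$; "generator in $\sigma[M]$" means every module in $\sigma[M]$ is a quotient of a direct sum of copies of $M$; a progenerator in $\sigma[M]$ is a finitely generated module that is projective in $\sigma[M]$ and a generator in $\sigma[M]$. $\widehat{M}$ is the $M$-injective hull of $M$ (its injective hull in the category $\sigma[M]$). A module $A$ is $M$-injective if every homomorphism from a submodule of $M$ to $A$ extends to $M$ (for $A\in\sigma[M]$ this is the same as being injective in $\sigma[M]$). $M$ is co-semisimple if every simple module in $\sigma[M]$ is $M$-injective. A submodule $N$ of a module $X$ is fully invariant if $f(N)\le N$ for all $f\in \mathrm{End}_R(X)$; $X$ is $FI$-simple if it has no nonzero proper fully invariant submodules. A left annihilator in $M$ is a submodule of the form $\bigcap_{f\in Y}\mathrm{Ker}(f)$ for some $Y\subseteq \mathrm{End}_R(M)$. $M$ is a Goldie module if it satisfies ACC on left annihilators and has finite uniform dimension. *)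

theory Defs
  imports "HOL-Algebra.Module" "HOL-Algebra.AbelCoset"
begin

text \<open>
  \<open>HOL-Algebra\<close> has modules over commutative rings only.  Here the ring is an arbitrary
  associative ring with unit, and the locale \<^locale>\<open>module\<close> is copied with
  \<^locale>\<open>ring\<close> in place of \<^locale>\<open>cring\<close>.  The record type \<open>('r, 'u) module\<close> and the
  predicate \<^locale>\<open>submodule\<close> do not mention commutativity and are taken from the library.

  Universe convention: \<open>R\<close>-Mod is rendered as the left \<open>R\<close>-modules whose carrier is a subset of
  one type \<open>'u\<close>; every quantifier over modules below ranges over \<open>('r, 'u) module\<close>, and
  index sets of direct sums are subsets of \<open>'u\<close> too.
  If \<open>'u\<close> is infinite, none of the notions depends on \<open>'u\<close>:

  \<^item> If \<open>X\<close> is in \<open>\<sigma>[M]\<close> or is generated by \<open>M\<close>, at most \<open>|X| \<cdot> \<aleph>\<^sub>0\<close> copies of \<open>M\<close> are needed,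
    finitely many for each element of \<open>X\<close>; quotients of such direct sums have at most \<open>|'u|\<close>
    elements, so they have isomorphic copies inside \<open>'u\<close>.
  \<^item> A finitely generated module in \<open>\<sigma>[M]\<close> is a subquotient of some \<open>M\<^sup>n\<close>, so it has an isomorphic
    copy inside \<open>'u\<close>.  Whether \<open>M\<close> is a generator in \<open>\<sigma>[M]\<close> is decided by the cyclic modules
    in \<open>\<sigma>[M]\<close>, and, for finitely generated \<open>M\<close>, projectivity of \<open>M\<close> in \<open>\<sigma>[M]\<close> is decided by
    short exact sequences with finitely generated middle term.  Simple modules are cyclic.
  \<^item> Injectivity in \<open>\<sigma>[M]\<close> is decided by the inclusions of submodules of \<open>M\<close>.
\<close>

locale left_module = R?: ring R + M?: abelian_group M
  for R :: "('r, 'k) ring_scheme" (structure) and M :: "('r, 'a, 'm) module_scheme" (structure) +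
  assumes smult_closed [simp, intro]:
      "\<lbrakk>a \<in> carrier R; x \<in> carrier M\<rbrakk> \<Longrightarrow> a \<odot>\<^bsub>M\<^esub> x \<in> carrier M"
    and smult_l_distr:
      "\<lbrakk>a \<in> carrier R; b \<in> carrier R; x \<in> carrier M\<rbrakk> \<Longrightarrow>
        (a \<oplus>\<^bsub>R\<^esub> b) \<odot>\<^bsub>M\<^esub> x = a \<odot>\<^bsub>M\<^esub> x \<oplus>\<^bsub>M\<^esub> b \<odot>\<^bsub>M\<^esub> x"
    and smult_r_distr:
      "\<lbrakk>a \<in> carrier R; x \<in> carrier M; y \<in> carrier M\<rbrakk> \<Longrightarrow>
        a \<odot>\<^bsub>M\<^esub> (x \<oplus>\<^bsub>M\<^esub> y) = a \<odot>\<^bsub>M\<^esub> x \<oplus>\<^bsub>M\<^esub> a \<odot>\<^bsub>M\<^esub> y"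
    and smult_assoc1:
      "\<lbrakk>a \<in> carrier R; b \<in> carrier R; x \<in> carrier M\<rbrakk> \<Longrightarrow>
        (a \<otimes>\<^bsub>R\<^esub> b) \<odot>\<^bsub>M\<^esub> x = a \<odot>\<^bsub>M\<^esub> (b \<odot>\<^bsub>M\<^esub> x)"
    and smult_one [simp]:
      "x \<in> carrier M \<Longrightarrow> \<one>\<^bsub>R\<^esub> \<odot>\<^bsub>M\<^esub> x = x"


subsection \<open>Homomorphisms, submodules, direct sums\<close>

text \<open>Homomorphisms are extensional functions, so that equality in \<open>Hom\<close> is equality on the carrier.\<close>

definition Hom :: "('r, 'k) ring_scheme \<Rightarrow> ('r, 'a) module \<Rightarrow> ('r, 'b) module \<Rightarrow> ('a \<Rightarrow> 'b) set" where
  "Hom R A B = {f \<in> carrier A \<rightarrow>\<^sub>E carrier B.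
     (\<forall>x\<in>carrier A. \<forall>y\<in>carrier A. f (x \<oplus>\<^bsub>A\<^esub> y) = f x \<oplus>\<^bsub>B\<^esub> f y) \<and>
     (\<forall>r\<in>carrier R. \<forall>x\<in>carrier A. f (r \<odot>\<^bsub>A\<^esub> x) = r \<odot>\<^bsub>B\<^esub> f x)}"

abbreviation End :: "('r, 'k) ring_scheme \<Rightarrow> ('r, 'a) module \<Rightarrow> ('a \<Rightarrow> 'a) set" where
  "End R A \<equiv> Hom R A A"

definition Ker :: "('r, 'a) module \<Rightarrow> ('r, 'b) module \<Rightarrow> ('a \<Rightarrow> 'b) \<Rightarrow> 'a set" where
  "Ker A B f = {x \<in> carrier A. f x = \<zero>\<^bsub>B\<^esub>}"

definition Mono_hom :: "('r, 'k) ring_scheme \<Rightarrow> ('r, 'a) module \<Rightarrow> ('r, 'b) module \<Rightarrow> ('a \<Rightarrow> 'b) set" where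
  "Mono_hom R A B = {f \<in> Hom R A B. inj_on f (carrier A)}"

definition Epi_hom :: "('r, 'k) ring_scheme \<Rightarrow> ('r, 'a) module \<Rightarrow> ('r, 'b) module \<Rightarrow> ('a \<Rightarrow> 'b) set" where
  "Epi_hom R A B = {f \<in> Hom R A B. f ` carrier A = carrier B}"

definition embeds_in :: "('r, 'k) ring_scheme \<Rightarrow> ('r, 'a) module \<Rightarrow> ('r, 'b) module \<Rightarrow> bool" where
  "embeds_in R A B \<longleftrightarrow> Mono_hom R A B \<noteq> {}"

definition is_quotient_of :: "('r, 'k) ring_scheme \<Rightarrow> ('r, 'b) module \<Rightarrow> ('r, 'a) module \<Rightarrow> bool" where
  "is_quotient_of R B A \<longleftrightarrow> Epi_hom R A B \<noteq> {}"

definition submodule_span :: "('r, 'k) ring_scheme \<Rightarrow> ('r, 'a) module \<Rightarrow> 'a set \<Rightarrow> 'a set" where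
  "submodule_span R M S = \<Inter> {N. submodule N R M \<and> S \<subseteq> N}"

definition finitely_generated :: "('r, 'k) ring_scheme \<Rightarrow> ('r, 'a) module \<Rightarrow> bool" where
  "finitely_generated R M \<longleftrightarrow>
     (\<exists>S. finite S \<and> S \<subseteq> carrier M \<and> submodule_span R M S = carrier M)"

text \<open>
  The direct sum of copies of \<open>M\<close> indexed by \<open>I\<close>: families with finite support.
  The two ring fields of the module record are irrelevant.
\<close>

definition direct_sum_copies :: "'i set \<Rightarrow> ('r, 'a) module \<Rightarrow> ('r, 'i \<Rightarrow> 'a) module" where
  "direct_sum_copies I M =
     \<lparr>carrier = {x \<in> I \<rightarrow>\<^sub>E carrier M. finite {i \<in> I. x i \<noteq> \<zero>\<^bsub>M\<^esub>}},
      mult = undefined, one = undefined,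
      zero = (\<lambda>i\<in>I. \<zero>\<^bsub>M\<^esub>),
      add = (\<lambda>x y. \<lambda>i\<in>I. x i \<oplus>\<^bsub>M\<^esub> y i),
      smult = (\<lambda>r x. \<lambda>i\<in>I. r \<odot>\<^bsub>M\<^esub> x i)\<rparr>"


subsection \<open>The category \<open>\<sigma>[M]\<close>\<close>

definition sigma_cat :: "('r, 'k) ring_scheme \<Rightarrow> ('r, 'u) module \<Rightarrow> ('r, 'u) module set" where
  "sigma_cat R M = {X. left_module R X \<and>
     (\<exists>(I :: 'u set) (Q :: ('r, 'u) module).
        left_module R Q \<and> is_quotient_of R Q (direct_sum_copies I M) \<and> embeds_in R X Q)}"

definition generator_in_sigma :: "('r, 'k) ring_scheme \<Rightarrow> ('r, 'u) module \<Rightarrow> bool" where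
  "generator_in_sigma R M \<longleftrightarrow>
     (\<forall>X\<in>sigma_cat R M. \<exists>I :: 'u set. is_quotient_of R X (direct_sum_copies I M))"

definition short_exact :: "('r, 'k) ring_scheme \<Rightarrow> ('r, 'a) module \<Rightarrow> ('r, 'b) module \<Rightarrow> ('r, 'c) module
    \<Rightarrow> ('a \<Rightarrow> 'b) \<Rightarrow> ('b \<Rightarrow> 'c) \<Rightarrow> bool" where
  "short_exact R A B C f g \<longleftrightarrow>
     f \<in> Mono_hom R A B \<and> g \<in> Epi_hom R B C \<and> f ` carrier A = Ker B C g"

text \<open>
  \<open>Hom(M,-)\<close> takes \<open>0 \<rightarrow> A \<rightarrow> B \<rightarrow> C \<rightarrow> 0\<close> to a short exact sequence
  \<open>0 \<rightarrow> Hom(M,A) \<rightarrow> Hom(M,B) \<rightarrow> Hom(M,C) \<rightarrow> 0\<close> of abelian groups.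
\<close>

definition projective_in_sigma :: "('r, 'k) ring_scheme \<Rightarrow> ('r, 'u) module \<Rightarrow> bool" where
  "projective_in_sigma R M \<longleftrightarrow>
     (\<forall>A\<in>sigma_cat R M. \<forall>B\<in>sigma_cat R M. \<forall>C\<in>sigma_cat R M. \<forall>f g. short_exact R A B C f g \<longrightarrow>
        inj_on (\<lambda>h. compose (carrier M) f h) (Hom R M A) \<and>
        (\<lambda>h. compose (carrier M) f h) ` Hom R M A =
          {h \<in> Hom R M B. compose (carrier M) g h = (\<lambda>x\<in>carrier M. \<zero>\<^bsub>C\<^esub>)} \<and>
        (\<lambda>h. compose (carrier M) g h) ` Hom R M B = Hom R M C)"

definition progenerator_in_sigma :: "('r, 'k) ring_scheme \<Rightarrow> ('r, 'u) module \<Rightarrow> bool" where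
  "progenerator_in_sigma R M \<longleftrightarrow>
     finitely_generated R M \<and> projective_in_sigma R M \<and> generator_in_sigma R M"

definition injective_in_sigma :: "('r, 'k) ring_scheme \<Rightarrow> ('r, 'u) module \<Rightarrow> ('r, 'u) module \<Rightarrow> bool" where
  "injective_in_sigma R M E \<longleftrightarrow> E \<in> sigma_cat R M \<and>
     (\<forall>A\<in>sigma_cat R M. \<forall>B\<in>sigma_cat R M. \<forall>f\<in>Mono_hom R A B. \<forall>g\<in>Hom R A E.
        \<exists>h\<in>Hom R B E. compose (carrier A) h f = g)"

definition essential_submodule :: "('r, 'k) ring_scheme \<Rightarrow> ('r, 'a) module \<Rightarrow> 'a set \<Rightarrow> bool" where
  "essential_submodule R X N \<longleftrightarrow> submodule N R X \<and>
     (\<forall>K. submodule K R X \<and> K \<noteq> {\<zero>\<^bsub>X\<^esub>} \<longrightarrow> N \<inter> K \<noteq> {\<zero>\<^bsub>X\<^esub>})"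

text \<open>\<open>H\<close> is an injective hull of \<open>M\<close> in \<open>\<sigma>[M]\<close>, i.e. (a copy of) the \<open>M\<close>-injective hull of \<open>M\<close>.\<close>

definition injective_hull_in_sigma :: "('r, 'k) ring_scheme \<Rightarrow> ('r, 'u) module \<Rightarrow> ('r, 'u) module \<Rightarrow> bool" where
  "injective_hull_in_sigma R M H \<longleftrightarrow> injective_in_sigma R M H \<and>
     (\<exists>\<iota>\<in>Mono_hom R M H. essential_submodule R H (\<iota> ` carrier M))"


subsection \<open>Properties of modules\<close>

definition M_injective :: "('r, 'k) ring_scheme \<Rightarrow> ('r, 'a) module \<Rightarrow> ('r, 'b) module \<Rightarrow> bool" where
  "M_injective R M A \<longleftrightarrow>
     (\<forall>N. submodule N R M \<longrightarrow>
        (\<forall>f\<in>Hom R (M\<lparr>carrier := N\<rparr>) A. \<exists>g\<in>Hom R M A. \<forall>x\<in>N. g x = f x))"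

definition simple_mod :: "('r, 'k) ring_scheme \<Rightarrow> ('r, 'a) module \<Rightarrow> bool" where
  "simple_mod R S \<longleftrightarrow> carrier S \<noteq> {\<zero>\<^bsub>S\<^esub>} \<and>
     (\<forall>N. submodule N R S \<longrightarrow> N = {\<zero>\<^bsub>S\<^esub>} \<or> N = carrier S)"

definition co_semisimple :: "('r, 'k) ring_scheme \<Rightarrow> ('r, 'u) module \<Rightarrow> bool" where
  "co_semisimple R M \<longleftrightarrow> (\<forall>S\<in>sigma_cat R M. simple_mod R S \<longrightarrow> M_injective R M S)"

definition indecomposable :: "('r, 'k) ring_scheme \<Rightarrow> ('r, 'a) module \<Rightarrow> bool" where
  "indecomposable R X \<longleftrightarrow> carrier X \<noteq> {\<zero>\<^bsub>X\<^esub>} \<and>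
     (\<forall>N K. submodule N R X \<and> submodule K R X \<and> N \<inter> K = {\<zero>\<^bsub>X\<^esub>} \<and> N <+>\<^bsub>X\<^esub> K = carrier X
        \<longrightarrow> N = {\<zero>\<^bsub>X\<^esub>} \<or> K = {\<zero>\<^bsub>X\<^esub>})"

definition fully_invariant :: "('r, 'k) ring_scheme \<Rightarrow> ('r, 'a) module \<Rightarrow> 'a set \<Rightarrow> bool" where
  "fully_invariant R X N \<longleftrightarrow> submodule N R X \<and> (\<forall>f\<in>End R X. f ` N \<subseteq> N)"

definition FI_simple :: "('r, 'k) ring_scheme \<Rightarrow> ('r, 'a) module \<Rightarrow> bool" where
  "FI_simple R X \<longleftrightarrow>
     (\<forall>N. fully_invariant R X N \<longrightarrow> N = {\<zero>\<^bsub>X\<^esub>} \<or> N = carrier X)"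

text \<open>The left annihilator of \<open>Y = {}\<close> is \<open>M\<close>, whence the intersection with the carrier.\<close>

definition left_annihilator :: "('r, 'k) ring_scheme \<Rightarrow> ('r, 'a) module \<Rightarrow> 'a set \<Rightarrow> bool" where
  "left_annihilator R M N \<longleftrightarrow>
     (\<exists>Y. Y \<subseteq> End R M \<and> N = carrier M \<inter> (\<Inter>f\<in>Y. Ker M M f))"

definition ACC_left_annihilators :: "('r, 'k) ring_scheme \<Rightarrow> ('r, 'a) module \<Rightarrow> bool" where
  "ACC_left_annihilators R M \<longleftrightarrow>
     (\<forall>N :: nat \<Rightarrow> 'a set. (\<forall>n. left_annihilator R M (N n)) \<and> (\<forall>n. N n \<subseteq> N (Suc n))
        \<longrightarrow> (\<exists>n0. \<forall>n\<ge>n0. N n = N n0))"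

definition independent_submodules ::
    "('r, 'k) ring_scheme \<Rightarrow> ('r, 'a) module \<Rightarrow> 'i set \<Rightarrow> ('i \<Rightarrow> 'a set) \<Rightarrow> bool" where
  "independent_submodules R M I N \<longleftrightarrow> (\<forall>i\<in>I. submodule (N i) R M) \<and>
     (\<forall>i\<in>I. N i \<inter> submodule_span R M (\<Union>j\<in>I - {i}. N j) = {\<zero>\<^bsub>M\<^esub>})"

text \<open>\<open>M\<close> contains no infinite direct sum of nonzero submodules.\<close>

definition finite_uniform_dimension :: "('r, 'k) ring_scheme \<Rightarrow> ('r, 'a) module \<Rightarrow> bool" where
  "finite_uniform_dimension R M \<longleftrightarrow>
     \<not> (\<exists>N :: nat \<Rightarrow> 'a set. independent_submodules R M UNIV N \<and> (\<forall>n. N n \<noteq> {\<zero>\<^bsub>M\<^esub>}))"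

definition Goldie_module :: "('r, 'k) ring_scheme \<Rightarrow> ('r, 'a) module \<Rightarrow> bool" where
  "Goldie_module R M \<longleftrightarrow> ACC_left_annihilators R M \<and> finite_uniform_dimension R M"

end

(*
  Call a homomorphism singular if its kernel is essential.  Co-semisimplicity and projectivity give
  x(K) = x(M) for every fully invariant K <= M and every endomorphism x of M with x(M) <= K:
  otherwise a maximal submodule P >= K + Ker x and the injectivity of M/P yield g : M -> M/P with
  g o x = p (p : M -> M/P the projection); lifting g along p to an endomorphism of M shows
  g(K) = 0, so p = 0.  Hence z t z = 0 for all t in End(M) forces z = 0, and ACC on left
  annihilators then excludes nonzero singular homs M -> M, and so also M -> Mhat and M -> E.

  For N <= E nonzero and fully invariant, N is essential in E.  Finite uniform dimension and
  injectivity of E make Hom(M,E) finitely generated over End(E) (modulo common kernels), so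
  K = {m. f m in N for all f : M -> E} is a finite intersection of essential submodules.
  As K is fully invariant, x(K) = x(M) and projectivity provide, for finitely many endomorphisms
  x_i with image in K, an a with image in K and x_i a = x_i.  Choose the x_i with the least
  possible common kernel A, that of all endomorphisms with image in K.  A meets K trivially by
  the condition on z t z, so A = 0 because K is essential.  As (1 - a)M <= A, this gives a = 1,
  whence K = M and N = E.
*)

theory Submission
  imports Defs
begin

subsection \<open>Linear maps and submodules\<close>

text \<open>The generator hypothesis enters in one form: every submodule of a module in \<sigma>[M]
  is the sum of the images of the maps from M into it. Nonsingularity controls only maps that start
  at M, so a claim about a submodule A is tested on maps M \<rightarrow> A; essential kernels
  survive this, since preimages of essential submodules are essential. The case M = R is a guide.
  Endomorphisms are right multiplications, fully invariant submodules are two-sided ideals, and x(K)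
  = x(M) says that c lies in K c for every c in K, the weak regularity of left V-rings.
  Nonsingularity and finiteness conditions alone do not make an essential ideal improper, as 2Z in Z
  shows; there 2 is not in 4Z. Weak regularity supplies one local unit for each element, and finite
  uniform dimension makes finitely many elements decisive. That a nonzero submodule N of E is
  essential is obtained without a theory of hulls inside E: a projection onto N, defined on an
  essential submodule of E, extends to E, nonsingularity makes the extension idempotent, and
  indecomposability decides.\<close>

definition lin :: "('r, 'k) ring_scheme \<Rightarrow> ('r, 'a) module \<Rightarrow> ('r, 'b) module \<Rightarrow> ('a \<Rightarrow> 'b) \<Rightarrow> bool" where
  "lin R A B f \<longleftrightarrow> f \<in> carrier A \<rightarrow> carrier B \<and>
     (\<forall>x\<in>carrier A. \<forall>y\<in>carrier A. f (x \<oplus>\<^bsub>A\<^esub> y) = f x \<oplus>\<^bsub>B\<^esub> f y) \<and>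
     (\<forall>r\<in>carrier R. \<forall>x\<in>carrier A. f (r \<odot>\<^bsub>A\<^esub> x) = r \<odot>\<^bsub>B\<^esub> f x)"

lemma linI:
  assumes "\<And>x. x \<in> carrier A \<Longrightarrow> f x \<in> carrier B"
    and "\<And>x y. x \<in> carrier A \<Longrightarrow> y \<in> carrier A \<Longrightarrow> f (x \<oplus>\<^bsub>A\<^esub> y) = f x \<oplus>\<^bsub>B\<^esub> f y"
    and "\<And>r x. r \<in> carrier R \<Longrightarrow> x \<in> carrier A \<Longrightarrow> f (r \<odot>\<^bsub>A\<^esub> x) = r \<odot>\<^bsub>B\<^esub> f x"
  shows "lin R A B f"
  using assms by (auto simp: lin_def)

lemma lin_closed: "lin R A B f \<Longrightarrow> x \<in> carrier A \<Longrightarrow> f x \<in> carrier B"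
  and lin_add: "lin R A B f \<Longrightarrow> x \<in> carrier A \<Longrightarrow> y \<in> carrier A \<Longrightarrow> f (x \<oplus>\<^bsub>A\<^esub> y) = f x \<oplus>\<^bsub>B\<^esub> f y"
  and lin_smult: "lin R A B f \<Longrightarrow> r \<in> carrier R \<Longrightarrow> x \<in> carrier A \<Longrightarrow> f (r \<odot>\<^bsub>A\<^esub> x) = r \<odot>\<^bsub>B\<^esub> f x"
  by (auto simp: lin_def)

text \<open>Dropping extensionality lets composites, sums and differences of maps be plain lambda
  terms; \<open>restrict_in_Hom\<close> leads back to \<open>Hom\<close> wherever a definition
  demands it.\<close>

lemma Hom_iff_lin: "f \<in> Hom R A B \<longleftrightarrow> lin R A B f \<and> f \<in> extensional (carrier A)"
  by (auto simp: Hom_def lin_def PiE_def)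

text \<open>Closure of \<open>A\<close> under the two operations stands in for
  \<open>left_module R A\<close>, so that the lemma applies to a direct sum of copies without a
  proof that it is a module.\<close>

lemma lin_restrict:
  assumes "lin R A B f"
    "\<And>x y. x \<in> carrier A \<Longrightarrow> y \<in> carrier A \<Longrightarrow> x \<oplus>\<^bsub>A\<^esub> y \<in> carrier A"
    "\<And>r x. r \<in> carrier R \<Longrightarrow> x \<in> carrier A \<Longrightarrow> r \<odot>\<^bsub>A\<^esub> x \<in> carrier A"
  shows "lin R A B (restrict f (carrier A))"
  using assms(2,3) lin_closed[OF assms(1)] lin_add[OF assms(1)] lin_smult[OF assms(1)]
  by (intro linI) auto

lemma restrict_in_Hom:
  assumes "lin R A B f" "left_module R A"
  shows "restrict f (carrier A) \<in> Hom R A B"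
proof -
  interpret A: left_module R A by fact
  show ?thesis unfolding Hom_iff_lin using lin_restrict[OF assms(1)] by auto
qed

lemma lin_comp: "lin R A B f \<Longrightarrow> lin R B C g \<Longrightarrow> lin R A C (\<lambda>x. g (f x))"
  by (auto simp: lin_def Pi_iff)

lemma lin_id: "lin R A A (\<lambda>x. x)"
  by (simp add: lin_def)

lemma lin_subdomain: "lin R A B f \<Longrightarrow> N \<subseteq> carrier A \<Longrightarrow> lin R (A\<lparr>carrier := N\<rparr>) B f"
  by (rule linI) (simp_all add: lin_closed lin_add lin_smult subset_iff)

lemma lin_subcodomain:
  assumes "lin R A B f" "\<And>x. x \<in> carrier A \<Longrightarrow> f x \<in> N"
  shows "lin R A (B\<lparr>carrier := N\<rparr>) f"
  by (rule linI) (simp_all add: assms(2) lin_add[OF assms(1)] lin_smult[OF assms(1)])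

lemma lin_from_subcodomain:
  assumes "lin R A (B\<lparr>carrier := N\<rparr>) f" "N \<subseteq> carrier B"
  shows "lin R A B f"
  using lin_closed[OF assms(1)] lin_add[OF assms(1)] lin_smult[OF assms(1)] assms(2)
  by (intro linI) auto

context left_module
begin

lemma smult_l_null [simp]:
  assumes "x \<in> carrier M" shows "\<zero> \<odot>\<^bsub>M\<^esub> x = \<zero>\<^bsub>M\<^esub>"
proof -
  have "\<zero> \<odot>\<^bsub>M\<^esub> x \<oplus>\<^bsub>M\<^esub> \<zero> \<odot>\<^bsub>M\<^esub> x = \<zero> \<odot>\<^bsub>M\<^esub> x"
    using smult_l_distr[of \<zero> \<zero> x] assms by simp
  then show ?thesis
    using assms by (metis M.add.r_cancel_one' smult_closed R.zero_closed)
qed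

lemma smult_r_null [simp]:
  assumes "a \<in> carrier R" shows "a \<odot>\<^bsub>M\<^esub> \<zero>\<^bsub>M\<^esub> = \<zero>\<^bsub>M\<^esub>"
proof -
  have "a \<odot>\<^bsub>M\<^esub> \<zero>\<^bsub>M\<^esub> \<oplus>\<^bsub>M\<^esub> a \<odot>\<^bsub>M\<^esub> \<zero>\<^bsub>M\<^esub> = a \<odot>\<^bsub>M\<^esub> \<zero>\<^bsub>M\<^esub>"
    using smult_r_distr[of a "\<zero>\<^bsub>M\<^esub>" "\<zero>\<^bsub>M\<^esub>"] assms by simp
  then show ?thesis
    using assms by (metis M.add.r_cancel_one' smult_closed M.zero_closed)
qed

lemma smult_minus_one:
  assumes "x \<in> carrier M" shows "(\<ominus> \<one>) \<odot>\<^bsub>M\<^esub> x = \<ominus>\<^bsub>M\<^esub> x"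
proof -
  have "(\<ominus> \<one>) \<odot>\<^bsub>M\<^esub> x \<oplus>\<^bsub>M\<^esub> x = \<zero>\<^bsub>M\<^esub>"
    using smult_l_distr[of "\<ominus> \<one>" \<one> x] assms by (simp add: R.l_neg)
  then show ?thesis
    using assms by (metis M.minus_equality R.a_inv_closed R.one_closed smult_closed)
qed

lemma smult_minus:
  assumes "a \<in> carrier R" "x \<in> carrier M" shows "a \<odot>\<^bsub>M\<^esub> (\<ominus>\<^bsub>M\<^esub> x) = \<ominus>\<^bsub>M\<^esub> (a \<odot>\<^bsub>M\<^esub> x)"
proof -
  have "a \<odot>\<^bsub>M\<^esub> (\<ominus>\<^bsub>M\<^esub> x) \<oplus>\<^bsub>M\<^esub> a \<odot>\<^bsub>M\<^esub> x = \<zero>\<^bsub>M\<^esub>"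
    using smult_r_distr[of a "\<ominus>\<^bsub>M\<^esub> x" x] assms by (simp add: M.l_neg)
  then show ?thesis
    using assms by (metis M.minus_equality M.a_inv_closed smult_closed)
qed

text \<open>Negatives are multiples by \<open>\<ominus> \<one>\<close>, so the subgroup condition in
  \<open>submodule\<close> reduces to zero, sums and scalar multiples.\<close>

lemma submoduleI:
  assumes "N \<subseteq> carrier M" "\<zero>\<^bsub>M\<^esub> \<in> N"
    and "\<And>x y. x \<in> N \<Longrightarrow> y \<in> N \<Longrightarrow> x \<oplus>\<^bsub>M\<^esub> y \<in> N"
    and "\<And>a x. a \<in> carrier R \<Longrightarrow> x \<in> N \<Longrightarrow> a \<odot>\<^bsub>M\<^esub> x \<in> N"
  shows "submodule N R M"
proof -
  have "\<ominus>\<^bsub>M\<^esub> x \<in> N" if "x \<in> N" for x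
    using assms(4)[of "\<ominus> \<one>" x] that assms(1) smult_minus_one by auto
  then show ?thesis
    using assms by (intro submodule.intro subgroup.intro submodule_axioms.intro) (auto simp: a_inv_def)
qed

lemma submoduleD:
  assumes "submodule N R M"
  shows "N \<subseteq> carrier M" "\<zero>\<^bsub>M\<^esub> \<in> N"
    and "\<And>x. x \<in> N \<Longrightarrow> x \<in> carrier M"
    and "\<And>x y. x \<in> N \<Longrightarrow> y \<in> N \<Longrightarrow> x \<oplus>\<^bsub>M\<^esub> y \<in> N"
    and "\<And>x y. x \<in> N \<Longrightarrow> y \<in> N \<Longrightarrow> x \<ominus>\<^bsub>M\<^esub> y \<in> N"
    and "\<And>x. x \<in> N \<Longrightarrow> \<ominus>\<^bsub>M\<^esub> x \<in> N"
    and "\<And>a x. a \<in> carrier R \<Longrightarrow> x \<in> N \<Longrightarrow> a \<odot>\<^bsub>M\<^esub> x \<in> N"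
proof -
  interpret submodule N R M by fact
  show s: "N \<subseteq> carrier M" "\<zero>\<^bsub>M\<^esub> \<in> N" "\<And>x y. x \<in> N \<Longrightarrow> y \<in> N \<Longrightarrow> x \<oplus>\<^bsub>M\<^esub> y \<in> N"
    and "\<And>x. x \<in> N \<Longrightarrow> x \<in> carrier M"
    and "\<And>a x. a \<in> carrier R \<Longrightarrow> x \<in> N \<Longrightarrow> a \<odot>\<^bsub>M\<^esub> x \<in> N"
    using subset one_closed m_closed smult_closed by auto
  show i: "\<And>x. x \<in> N \<Longrightarrow> \<ominus>\<^bsub>M\<^esub> x \<in> N"
    using m_inv_closed by (auto simp: a_inv_def)
  show "\<And>x y. x \<in> N \<Longrightarrow> y \<in> N \<Longrightarrow> x \<ominus>\<^bsub>M\<^esub> y \<in> N"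
    using s i by (auto simp: a_minus_def)
qed

lemma submodule_carrier: "submodule (carrier M) R M"
  by (rule submoduleI) auto

lemma submodule_zero: "submodule {\<zero>\<^bsub>M\<^esub>} R M"
  by (rule submoduleI) auto

lemma submodule_Int:
  assumes "submodule N R M" "submodule K R M" shows "submodule (N \<inter> K) R M"
  using submoduleD[OF assms(1)] submoduleD[OF assms(2)] by (intro submoduleI) auto

lemma submodule_Union_chain:
  assumes "C \<noteq> {}" "\<And>N. N \<in> C \<Longrightarrow> submodule N R M" "\<And>N K. N \<in> C \<Longrightarrow> K \<in> C \<Longrightarrow> N \<subseteq> K \<or> K \<subseteq> N"
  shows "submodule (\<Union>C) R M"
proof (rule submoduleI)
  fix x y assume "x \<in> \<Union>C" "y \<in> \<Union>C"
  then obtain N K where *: "N \<in> C" "x \<in> N" "K \<in> C" "y \<in> K" by blast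
  then consider "x \<in> K" | "y \<in> N" using assms(3) by blast
  then show "x \<oplus>\<^bsub>M\<^esub> y \<in> \<Union>C" using * submoduleD(4)[OF assms(2)] by cases blast+
next
  show "\<Union>C \<subseteq> carrier M" using submoduleD(1)[OF assms(2)] by blast
  show "\<zero>\<^bsub>M\<^esub> \<in> \<Union>C" using submoduleD(2)[OF assms(2)] assms(1) by blast
  show "a \<odot>\<^bsub>M\<^esub> x \<in> \<Union>C" if "a \<in> carrier R" "x \<in> \<Union>C" for a x
    using that submoduleD(7)[OF assms(2)] by blast
qed

lemma submodule_sum:
  assumes "submodule N R M" "submodule K R M"
  shows "submodule (N <+>\<^bsub>M\<^esub> K) R M"
proof -
  note n = submoduleD[OF assms(1)] and k = submoduleD[OF assms(2)]
  have *: "x \<in> N <+>\<^bsub>M\<^esub> K \<longleftrightarrow> (\<exists>a\<in>N. \<exists>b\<in>K. x = a \<oplus>\<^bsub>M\<^esub> b)" for x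
    by (auto simp: set_add_def')
  show ?thesis
  proof (rule submoduleI)
    show "N <+>\<^bsub>M\<^esub> K \<subseteq> carrier M" using n k by (auto simp: *)
    show "\<zero>\<^bsub>M\<^esub> \<in> N <+>\<^bsub>M\<^esub> K" unfolding * using n(2) k(2) M.r_zero M.zero_closed by metis
  next
    fix x y assume "x \<in> N <+>\<^bsub>M\<^esub> K" "y \<in> N <+>\<^bsub>M\<^esub> K"
    then obtain a b c d where h: "a \<in> N" "b \<in> K" "x = a \<oplus>\<^bsub>M\<^esub> b" "c \<in> N" "d \<in> K" "y = c \<oplus>\<^bsub>M\<^esub> d"
      unfolding * by blast
    have "x \<oplus>\<^bsub>M\<^esub> y = (a \<oplus>\<^bsub>M\<^esub> c) \<oplus>\<^bsub>M\<^esub> (b \<oplus>\<^bsub>M\<^esub> d)"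
      using h n(3) k(3) by (simp add: M.a_ac)
    then show "x \<oplus>\<^bsub>M\<^esub> y \<in> N <+>\<^bsub>M\<^esub> K" unfolding * using h n(4) k(4) by blast
  next
    fix a x assume "a \<in> carrier R" "x \<in> N <+>\<^bsub>M\<^esub> K"
    then show "a \<odot>\<^bsub>M\<^esub> x \<in> N <+>\<^bsub>M\<^esub> K" unfolding * using n(3,7) k(3,7) smult_r_distr by metis
  qed
qed

lemma sum_superset:
  assumes "submodule N R M" "submodule K R M"
  shows "N \<subseteq> N <+>\<^bsub>M\<^esub> K" "K \<subseteq> N <+>\<^bsub>M\<^esub> K"
proof -
  note n = submoduleD[OF assms(1)] and k = submoduleD[OF assms(2)]
  show "N \<subseteq> N <+>\<^bsub>M\<^esub> K"
    using n(3) k(2) M.r_zero by (force simp: set_add_def')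
  show "K \<subseteq> N <+>\<^bsub>M\<^esub> K"
    using n(2) k(3) M.l_zero by (force simp: set_add_def')
qed

lemma left_module_submodule:
  assumes "submodule N R M"
  shows "left_module R (M\<lparr>carrier := N\<rparr>)"
proof -
  note n = submoduleD[OF assms]
  have "abelian_group (M\<lparr>carrier := N\<rparr>)"
  proof (rule abelian_groupI)
    fix x assume "x \<in> carrier (M\<lparr>carrier := N\<rparr>)"
    then show "\<exists>y\<in>carrier (M\<lparr>carrier := N\<rparr>). y \<oplus>\<^bsub>M\<lparr>carrier := N\<rparr>\<^esub> x = \<zero>\<^bsub>M\<lparr>carrier := N\<rparr>\<^esub>"
      using n(3,6) M.l_neg by (intro bexI[of _ "\<ominus>\<^bsub>M\<^esub> x"]) auto
  qed (use n M.a_assoc M.a_comm in auto)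
  then show ?thesis
    using n smult_l_distr smult_r_distr smult_assoc1 R.ring_axioms
    by (intro left_module.intro left_module_axioms.intro) auto
qed

lemma submodule_of_submodule:
  assumes "submodule N R M"
  shows "submodule L R (M\<lparr>carrier := N\<rparr>) \<longleftrightarrow> submodule L R M \<and> L \<subseteq> N"
proof -
  interpret N: left_module R "M\<lparr>carrier := N\<rparr>" by (rule left_module_submodule[OF assms])
  show ?thesis
  proof safe
    assume L: "submodule L R (M\<lparr>carrier := N\<rparr>)"
    show "submodule L R M"
      using N.submoduleD[OF L] submoduleD[OF assms] by (intro submoduleI) auto
    show "x \<in> N" if "x \<in> L" for x using N.submoduleD(1)[OF L] that by auto
  next
    assume "submodule L R M" "L \<subseteq> N"
    then show "submodule L R (M\<lparr>carrier := N\<rparr>)"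
      using submoduleD[of L] by (intro N.submoduleI) auto
  qed
qed

end

locale linear_map = A: left_module R A + B: left_module R B
  for R :: "('r, 'k) ring_scheme" and A :: "('r, 'a) module" and B :: "('r, 'b) module" +
  fixes f
  assumes lin: "lin R A B f"
begin

lemmas closed [simp] = lin_closed[OF lin]
  and add = lin_add[OF lin]
  and smult = lin_smult[OF lin]

lemma zero [simp]: "f \<zero>\<^bsub>A\<^esub> = \<zero>\<^bsub>B\<^esub>"
proof -
  have "f \<zero>\<^bsub>A\<^esub> \<oplus>\<^bsub>B\<^esub> f \<zero>\<^bsub>A\<^esub> = f \<zero>\<^bsub>A\<^esub>" using add[of "\<zero>\<^bsub>A\<^esub>" "\<zero>\<^bsub>A\<^esub>"] by simp
  then show ?thesis by (metis A.M.zero_closed B.M.add.r_cancel_one' closed)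
qed

lemma uminus:
  assumes "x \<in> carrier A" shows "f (\<ominus>\<^bsub>A\<^esub> x) = \<ominus>\<^bsub>B\<^esub> f x"
proof -
  have "f (\<ominus>\<^bsub>A\<^esub> x) \<oplus>\<^bsub>B\<^esub> f x = \<zero>\<^bsub>B\<^esub>"
    using add[of "\<ominus>\<^bsub>A\<^esub> x" x] assms by (simp add: A.M.l_neg)
  then show ?thesis using B.M.minus_equality assms by simp
qed

lemma minus: "x \<in> carrier A \<Longrightarrow> y \<in> carrier A \<Longrightarrow> f (x \<ominus>\<^bsub>A\<^esub> y) = f x \<ominus>\<^bsub>B\<^esub> f y"
  unfolding a_minus_def using add[of x "\<ominus>\<^bsub>A\<^esub> y"] uminus[of y] by simp

lemma submodule_image:
  assumes "submodule N R A" shows "submodule (f ` N) R B"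
proof -
  note n = A.submoduleD[OF assms]
  show ?thesis
  proof (rule B.submoduleI)
    show "f ` N \<subseteq> carrier B" using n(3) by auto
    show "\<zero>\<^bsub>B\<^esub> \<in> f ` N" using n(2) zero by (metis imageI)
  next
    fix x y assume "x \<in> f ` N" "y \<in> f ` N"
    then obtain a b where "a \<in> N" "b \<in> N" "x = f a" "y = f b" by blast
    then have "x \<oplus>\<^bsub>B\<^esub> y = f (a \<oplus>\<^bsub>A\<^esub> b)" using n(3) by (simp add: add)
    then show "x \<oplus>\<^bsub>B\<^esub> y \<in> f ` N" using n(4) \<open>a \<in> N\<close> \<open>b \<in> N\<close> by blast
  next
    fix r x assume r: "r \<in> carrier R" and "x \<in> f ` N"
    then obtain a where "a \<in> N" "x = f a" by blast
    then have "r \<odot>\<^bsub>B\<^esub> x = f (r \<odot>\<^bsub>A\<^esub> a)" using n(3) r by (simp add: smult)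
    then show "r \<odot>\<^bsub>B\<^esub> x \<in> f ` N" using n(7) r \<open>a \<in> N\<close> by blast
  qed
qed

lemma submodule_preimage:
  assumes "submodule N R B" shows "submodule {x \<in> carrier A. f x \<in> N} R A"
  using B.submoduleD[OF assms] by (intro A.submoduleI) (auto simp: add smult)

lemma submodule_kernel: "submodule (Ker A B f) R A"
  using submodule_preimage[OF B.submodule_zero] by (simp add: Ker_def)

lemma inj_iff: "inj_on f (carrier A) \<longleftrightarrow> (\<forall>x\<in>carrier A. f x = \<zero>\<^bsub>B\<^esub> \<longrightarrow> x = \<zero>\<^bsub>A\<^esub>)"
proof
  assume "inj_on f (carrier A)"
  then show "\<forall>x\<in>carrier A. f x = \<zero>\<^bsub>B\<^esub> \<longrightarrow> x = \<zero>\<^bsub>A\<^esub>" using zero by (metis A.M.zero_closed inj_onD)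
next
  assume h: "\<forall>x\<in>carrier A. f x = \<zero>\<^bsub>B\<^esub> \<longrightarrow> x = \<zero>\<^bsub>A\<^esub>"
  show "inj_on f (carrier A)"
  proof (rule inj_onI)
    fix x y assume *: "x \<in> carrier A" "y \<in> carrier A" "f x = f y"
    then have "f (x \<ominus>\<^bsub>A\<^esub> y) = \<zero>\<^bsub>B\<^esub>" using minus[of x y] by (simp add: a_minus_def B.M.r_neg)
    then have 0: "x \<oplus>\<^bsub>A\<^esub> \<ominus>\<^bsub>A\<^esub> y = \<zero>\<^bsub>A\<^esub>" using h * by (simp add: a_minus_def)
    show "x = y" using A.M.minus_equality[OF 0] * by simp
  qed
qed

end

section \<open>Essential submodules, common kernels, sums of linear maps\<close>

lemma essentialI:
  assumes "submodule N R A"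
    and "\<And>K. submodule K R A \<Longrightarrow> (\<And>x. x \<in> N \<Longrightarrow> x \<in> K \<Longrightarrow> x = \<zero>\<^bsub>A\<^esub>) \<Longrightarrow> K \<subseteq> {\<zero>\<^bsub>A\<^esub>}"
    and "left_module R A"
  shows "essential_submodule R A N"
  unfolding essential_submodule_def
proof (intro conjI allI impI notI)
  interpret A: left_module R A by fact
  fix K assume K: "submodule K R A \<and> K \<noteq> {\<zero>\<^bsub>A\<^esub>}" and 0: "N \<inter> K = {\<zero>\<^bsub>A\<^esub>}"
  have "x = \<zero>\<^bsub>A\<^esub>" if "x \<in> N" "x \<in> K" for x
    using 0 that by (metis IntI singletonD)
  then have "K \<subseteq> {\<zero>\<^bsub>A\<^esub>}" using assms(2) K by (simp (no_asm_simp))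
  then show False using K A.submoduleD(2)[of K] by (simp add: subset_singleton_iff)
qed (fact assms)

lemma essentialD:
  assumes "left_module R A" "essential_submodule R A N" "submodule K R A"
    "\<And>x. x \<in> N \<Longrightarrow> x \<in> K \<Longrightarrow> x = \<zero>\<^bsub>A\<^esub>"
  shows "K = {\<zero>\<^bsub>A\<^esub>}"
proof -
  interpret A: left_module R A by fact
  have "submodule N R A" using assms(2) by (simp add: essential_submodule_def)
  then have "N \<inter> K = {\<zero>\<^bsub>A\<^esub>}" using assms(3,4) A.submoduleD(2) by blast
  then show ?thesis using assms(2,3) unfolding essential_submodule_def by blast
qed

text \<open>If K meets the preimage of N only in zero, then f(K) meets N only in zero, so f(K) = 0.
  But then K lies in the kernel, which is part of the preimage, and K = 0.\<close>

lemma (in linear_map) essential_preimage: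
  assumes "essential_submodule R B N"
  shows "essential_submodule R A {x \<in> carrier A. f x \<in> N}"
proof (rule essentialI[OF _ _ A.left_module_axioms])
  have N: "submodule N R B" using assms by (simp add: essential_submodule_def)
  then show "submodule {x \<in> carrier A. f x \<in> N} R A" by (rule submodule_preimage)
  fix K assume K: "submodule K R A" and 0: "\<And>x. x \<in> {x \<in> carrier A. f x \<in> N} \<Longrightarrow> x \<in> K \<Longrightarrow> x = \<zero>\<^bsub>A\<^esub>"
  have "y = \<zero>\<^bsub>B\<^esub>" if "y \<in> N" "y \<in> f ` K" for y
  proof -
    obtain x where x: "x \<in> K" "y = f x" using \<open>y \<in> f ` K\<close> by blast
    then have "x = \<zero>\<^bsub>A\<^esub>" using 0 that(1) A.submoduleD(3)[OF K] by simp
    then show ?thesis using x by simp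
  qed
  then have *: "f ` K = {\<zero>\<^bsub>B\<^esub>}"
    by (rule essentialD[OF B.left_module_axioms assms submodule_image[OF K]])
  show "K \<subseteq> {\<zero>\<^bsub>A\<^esub>}"
  proof
    fix x assume x: "x \<in> K"
    then have "f x = \<zero>\<^bsub>B\<^esub>" using * by blast
    then show "x \<in> {\<zero>\<^bsub>A\<^esub>}" using 0 x A.submoduleD(3)[OF K] B.submoduleD(2)[OF N] by simp
  qed
qed

lemma linear_mapI: "left_module R A \<Longrightarrow> left_module R B \<Longrightarrow> lin R A B f \<Longrightarrow> linear_map R A B f"
  by (simp add: linear_map.intro linear_map_axioms.intro)

lemma submodule_common_kernel:
  assumes "left_module R A" "left_module R B" "\<And>f. f \<in> F \<Longrightarrow> lin R A B f"
  shows "submodule {x \<in> carrier A. \<forall>f\<in>F. f x = \<zero>\<^bsub>B\<^esub>} R A"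
proof -
  interpret A: left_module R A by fact
  have f: "linear_map R A B f" if "f \<in> F" for f by (rule linear_mapI[OF assms(1,2) assms(3)[OF that]])
  show ?thesis
  proof (rule A.submoduleI)
    show "\<zero>\<^bsub>A\<^esub> \<in> {x \<in> carrier A. \<forall>f\<in>F. f x = \<zero>\<^bsub>B\<^esub>}" using linear_map.zero[OF f] by simp
  next
    fix x y assume xy: "x \<in> {x \<in> carrier A. \<forall>f\<in>F. f x = \<zero>\<^bsub>B\<^esub>}" "y \<in> {x \<in> carrier A. \<forall>f\<in>F. f x = \<zero>\<^bsub>B\<^esub>}"
    have "f (x \<oplus>\<^bsub>A\<^esub> y) = \<zero>\<^bsub>B\<^esub>" if "f \<in> F" for f
    proof -
      interpret f: linear_map R A B f by (rule f[OF that])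
      have "x \<in> carrier A" "y \<in> carrier A" "f x = \<zero>\<^bsub>B\<^esub>" "f y = \<zero>\<^bsub>B\<^esub>" using xy that by simp_all
      then show ?thesis by (simp add: f.add)
    qed
    then show "x \<oplus>\<^bsub>A\<^esub> y \<in> {x \<in> carrier A. \<forall>f\<in>F. f x = \<zero>\<^bsub>B\<^esub>}" using xy by simp
  next
    fix r x assume rx: "r \<in> carrier R" "x \<in> {x \<in> carrier A. \<forall>f\<in>F. f x = \<zero>\<^bsub>B\<^esub>}"
    have "f (r \<odot>\<^bsub>A\<^esub> x) = \<zero>\<^bsub>B\<^esub>" if "f \<in> F" for f
    proof -
      interpret f: linear_map R A B f by (rule f[OF that])
      have "x \<in> carrier A" "f x = \<zero>\<^bsub>B\<^esub>" using rx that by simp_all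
      then show ?thesis using rx(1) by (simp add: f.smult)
    qed
    then show "r \<odot>\<^bsub>A\<^esub> x \<in> {x \<in> carrier A. \<forall>f\<in>F. f x = \<zero>\<^bsub>B\<^esub>}" using rx by simp
  qed blast
qed

lemma essential_Int:
  assumes "left_module R A" "essential_submodule R A N" "essential_submodule R A K"
  shows "essential_submodule R A (N \<inter> K)"
  unfolding essential_submodule_def
proof (intro conjI allI impI)
  have N: "submodule N R A" and K: "submodule K R A"
    using assms(2,3) by (simp_all add: essential_submodule_def)
  then show "submodule (N \<inter> K) R A" by (rule left_module.submodule_Int[OF assms(1)])
  fix L assume L: "submodule L R A \<and> L \<noteq> {\<zero>\<^bsub>A\<^esub>}"
  then have "submodule (K \<inter> L) R A \<and> K \<inter> L \<noteq> {\<zero>\<^bsub>A\<^esub>}"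
    using assms(3) left_module.submodule_Int[OF assms(1) K] unfolding essential_submodule_def by blast
  then show "N \<inter> K \<inter> L \<noteq> {\<zero>\<^bsub>A\<^esub>}"
    using assms(2) unfolding essential_submodule_def Int_assoc by blast
qed

lemma essential_superset:
  assumes "left_module R A" "essential_submodule R A N" "submodule K R A" "N \<subseteq> K"
  shows "essential_submodule R A K"
proof (rule essentialI[OF assms(3) _ assms(1)])
  fix L assume "submodule L R A" "\<And>x. x \<in> K \<Longrightarrow> x \<in> L \<Longrightarrow> x = \<zero>\<^bsub>A\<^esub>"
  then show "L \<subseteq> {\<zero>\<^bsub>A\<^esub>}" using essentialD[OF assms(1,2), of L] assms(4) by auto
qed

lemma essential_carrier:
  assumes "left_module R A" shows "essential_submodule R A (carrier A)"
proof -
  interpret A: left_module R A by fact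
  show ?thesis
    using A.submodule_carrier A.submoduleD(1) by (auto simp: essential_submodule_def Int_absorb1)
qed

lemma lin_plus:
  assumes "left_module R A" "left_module R B" "lin R A B f" "lin R A B g"
  shows "lin R A B (\<lambda>x. f x \<oplus>\<^bsub>B\<^esub> g x)"
proof -
  interpret B: left_module R B by fact
  note f = assms(3) and g = assms(4)
  show ?thesis
  proof (rule linI)
    fix x y assume xy: "x \<in> carrier A" "y \<in> carrier A"
    show "f (x \<oplus>\<^bsub>A\<^esub> y) \<oplus>\<^bsub>B\<^esub> g (x \<oplus>\<^bsub>A\<^esub> y) = (f x \<oplus>\<^bsub>B\<^esub> g x) \<oplus>\<^bsub>B\<^esub> (f y \<oplus>\<^bsub>B\<^esub> g y)"
      using lin_closed[OF f] lin_closed[OF g] xy by (simp add: lin_add[OF f] lin_add[OF g] B.M.a_ac)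
  next
    fix r x assume rx: "r \<in> carrier R" "x \<in> carrier A"
    show "f (r \<odot>\<^bsub>A\<^esub> x) \<oplus>\<^bsub>B\<^esub> g (r \<odot>\<^bsub>A\<^esub> x) = r \<odot>\<^bsub>B\<^esub> (f x \<oplus>\<^bsub>B\<^esub> g x)"
      using lin_closed[OF f] lin_closed[OF g] rx
      by (simp add: lin_smult[OF f] lin_smult[OF g] B.smult_r_distr)
  qed (use lin_closed[OF f] lin_closed[OF g] in simp)
qed

lemma lin_minus:
  assumes "left_module R A" "left_module R B" "lin R A B f" "lin R A B g"
  shows "lin R A B (\<lambda>x. f x \<ominus>\<^bsub>B\<^esub> g x)"
proof -
  interpret B: left_module R B by fact
  note g = assms(4)
  have "lin R A B (\<lambda>x. \<ominus>\<^bsub>B\<^esub> g x)"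
    using lin_closed[OF g]
    by (intro linI) (simp_all add: lin_add[OF g] lin_smult[OF g] B.M.minus_add B.smult_minus)
  from lin_plus[OF assms(1-3) this] show ?thesis by (simp add: a_minus_def)
qed

subsection \<open>The category \<open>\<sigma>[M]\<close>\<close>

lemma sigma_catI:
  fixes M X Q :: "('r, 'u) module" and I :: "'u set"
  assumes "left_module R X" "left_module R Q" "is_quotient_of R Q (direct_sum_copies I M)" "embeds_in R X Q"
  shows "X \<in> sigma_cat R M"
  using assms unfolding sigma_cat_def by blast

lemma quotient_in_sigma:
  fixes M Q :: "('r, 'u) module"
  assumes "left_module R M" "left_module R Q" "lin R M Q p" "p ` carrier M = carrier Q"
  shows "Q \<in> sigma_cat R M"
proof -
  interpret p: linear_map R M Q p using assms by (intro linear_mapI)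
  \<comment> \<open>One copy of \<open>M\<close> is enough. Index sets are subsets of
    \<open>'u\<close>, and any element of that type can serve as the single index.\<close>
  define i :: 'u where "i = undefined"
  define D where "D = direct_sum_copies {i} M"
  have D: "carrier D = {i} \<rightarrow>\<^sub>E carrier M"
    by (auto simp: D_def direct_sum_copies_def)
  have D': "x i \<in> carrier M" if "x \<in> carrier D" for x using that by (auto simp: D)
  let ?e = "restrict (\<lambda>x. p (x i)) (carrier D)"
  have e: "?e (\<lambda>j\<in>{i}. m) = p m" if "m \<in> carrier M" for m
    using that by (simp add: D)
  have add: "x \<oplus>\<^bsub>D\<^esub> y = (\<lambda>j\<in>{i}. x j \<oplus>\<^bsub>M\<^esub> y j)" and smult: "r \<odot>\<^bsub>D\<^esub> x = (\<lambda>j\<in>{i}. r \<odot>\<^bsub>M\<^esub> x j)" for x y r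
    by (simp_all add: D_def direct_sum_copies_def)
  have "lin R D Q (\<lambda>x. p (x i))"
    by (rule linI) (simp_all add: D' add smult p.add p.smult)
  then have "lin R D Q ?e"
    by (rule lin_restrict) (auto simp: D add smult dest: PiE_mem)
  then have "?e \<in> Hom R D Q" by (simp add: Hom_iff_lin)
  moreover have "?e ` carrier D = carrier Q"
  proof
    show "?e ` carrier D \<subseteq> carrier Q" using D' by auto
    show "carrier Q \<subseteq> ?e ` carrier D"
    proof
      fix y assume "y \<in> carrier Q"
      then obtain m where m: "m \<in> carrier M" "y = p m" using assms(4) by blast
      have "(\<lambda>j\<in>{i}. m) \<in> carrier D" using m by (auto simp: D)
      then show "y \<in> ?e ` carrier D" using e[OF m(1)] m(2) by (metis imageI)
    qed
  qed
  ultimately have "?e \<in> Epi_hom R D Q" by (simp add: Epi_hom_def)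
  then have "is_quotient_of R Q (direct_sum_copies {i} M)"
    by (auto simp: is_quotient_of_def D_def)
  moreover have "embeds_in R Q Q"
    using restrict_in_Hom[OF lin_id assms(2)] by (auto simp: embeds_in_def Mono_hom_def)
  ultimately show ?thesis by (rule sigma_catI[OF assms(2,2)])
qed

lemma self_in_sigma: "left_module R M \<Longrightarrow> M \<in> sigma_cat R M"
  by (rule quotient_in_sigma[OF _ _ lin_id]) auto

lemma submodule_in_sigma:
  fixes M X :: "('r, 'u) module"
  assumes "X \<in> sigma_cat R M" "submodule N R X"
  shows "X\<lparr>carrier := N\<rparr> \<in> sigma_cat R M"
proof -
  from assms(1) obtain I :: "'u set" and Q :: "('r, 'u) module" and j where X: "left_module R X" "left_module R Q"
    "is_quotient_of R Q (direct_sum_copies I M)" "j \<in> Mono_hom R X Q"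
    unfolding sigma_cat_def embeds_in_def by blast
  interpret X: left_module R X by fact
  have N: "left_module R (X\<lparr>carrier := N\<rparr>)" by (rule X.left_module_submodule[OF assms(2)])
  have "lin R (X\<lparr>carrier := N\<rparr>) Q j"
    using X(4) X.submoduleD(1)[OF assms(2)] by (auto simp: Mono_hom_def Hom_iff_lin intro: lin_subdomain)
  from restrict_in_Hom[OF this N] have "restrict j N \<in> Mono_hom R (X\<lparr>carrier := N\<rparr>) Q"
    using X(4) X.submoduleD(1)[OF assms(2)] by (auto simp: Mono_hom_def inj_on_def)
  then have "embeds_in R (X\<lparr>carrier := N\<rparr>) Q" by (auto simp: embeds_in_def)
  then show ?thesis by (rule sigma_catI[OF N X(2,3)])
qed

section \<open>Generation, lifting, maximal submodules and quotients\<close>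

lemma direct_sum_copies_simps:
  "carrier (direct_sum_copies I M) = {x \<in> I \<rightarrow>\<^sub>E carrier M. finite {i \<in> I. x i \<noteq> \<zero>\<^bsub>M\<^esub>}}"
  "\<zero>\<^bsub>direct_sum_copies I M\<^esub> = (\<lambda>i\<in>I. \<zero>\<^bsub>M\<^esub>)"
  "x \<oplus>\<^bsub>direct_sum_copies I M\<^esub> y = (\<lambda>i\<in>I. x i \<oplus>\<^bsub>M\<^esub> y i)"
  "r \<odot>\<^bsub>direct_sum_copies I M\<^esub> x = (\<lambda>i\<in>I. r \<odot>\<^bsub>M\<^esub> x i)"
  by (simp_all add: direct_sum_copies_def)

text \<open>An element of \<open>X\<close> is the value under an epimorphism q of a family of finite
  support. Induction on the support splits off one coordinate at a time, and q restricted to one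
  coordinate is a linear map from \<open>M\<close> to \<open>X\<close>, to which
  \<open>trace\<close> applies.\<close>

lemma generator_trace:
  fixes M X :: "('r, 'u) module"
  assumes M: "left_module R M" and gen: "generator_in_sigma R M" and X: "X \<in> sigma_cat R M"
    and L: "submodule L R X"
    and trace: "\<And>f x. lin R M X f \<Longrightarrow> x \<in> carrier M \<Longrightarrow> f x \<in> L"
  shows "L = carrier X"
proof -
  interpret M: left_module R M by fact
  interpret X: left_module R X using X by (simp add: sigma_cat_def)
  note l = X.submoduleD[OF L]
  obtain I :: "'u set" and q where q: "q \<in> Epi_hom R (direct_sum_copies I M) X"
    using gen X unfolding generator_in_sigma_def is_quotient_of_def by blast
  let ?D = "direct_sum_copies I M"
  have q: "lin R ?D X q" "q ` carrier ?D = carrier X"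
    using q by (auto simp: Epi_hom_def Hom_iff_lin)
  have main: "q x \<in> L" if "finite F" "x \<in> carrier ?D" "{i \<in> I. x i \<noteq> \<zero>\<^bsub>M\<^esub>} \<subseteq> F" for F x
    using that
  proof (induction F arbitrary: x rule: finite_induct)
    case empty
    then have x0: "x i = \<zero>\<^bsub>M\<^esub>" if "i \<in> I" for i using that by blast
    have xe: "x \<in> extensional I" using empty by (simp add: direct_sum_copies_simps PiE_iff)
    \<comment> \<open>Here x is the zero family. Idempotence under addition gives q x = 0 without a
      module structure on the direct sum.\<close>
    have x: "x \<oplus>\<^bsub>?D\<^esub> x = x"
      by (rule extensionalityI[OF _ xe]) (simp_all add: direct_sum_copies_simps x0)
    have "q x \<oplus>\<^bsub>X\<^esub> q x = q x" using lin_add[OF q(1) empty(1) empty(1)] unfolding x by (rule sym)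
    then have "q x = \<zero>\<^bsub>X\<^esub>"
      using lin_closed[OF q(1) empty(1)] by (metis X.M.add.l_cancel_one)
    then show ?case using l by simp
  next
    case (insert i F)
    show ?case
    proof (cases "i \<in> I")
      case False
      then have "{i \<in> I. x i \<noteq> \<zero>\<^bsub>M\<^esub>} \<subseteq> F" using insert.prems(2) by auto
      then show ?thesis by (rule insert.IH[OF insert.prems(1)])
    next
      case True
      define e where "e m = (\<lambda>j\<in>I. if j = i then m else \<zero>\<^bsub>M\<^esub>)" for m
      define y where "y = (\<lambda>j\<in>I. if j = i then \<zero>\<^bsub>M\<^esub> else x j)"
      have "finite {j \<in> I. e m j \<noteq> \<zero>\<^bsub>M\<^esub>}" for m
        by (rule finite_subset[of _ "{i}"]) (auto simp: e_def)
      then have e_closed: "e m \<in> carrier ?D" if "m \<in> carrier M" for m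
        using that by (simp add: direct_sum_copies_simps e_def)
      have "lin R M ?D e"
        by (rule linI) (simp_all add: e_closed, simp_all add: direct_sum_copies_simps e_def fun_eq_iff)
      then have e: "lin R M X (\<lambda>m. q (e m))" using q(1) by (rule lin_comp)
      have x: "x \<in> I \<rightarrow>\<^sub>E carrier M" using insert.prems by (simp add: direct_sum_copies_simps)
      then have xi: "x i \<in> carrier M" using True by auto
      have y: "y \<in> carrier ?D"
      proof -
        have "{j \<in> I. y j \<noteq> \<zero>\<^bsub>M\<^esub>} \<subseteq> {j \<in> I. x j \<noteq> \<zero>\<^bsub>M\<^esub>}" by (auto simp: y_def)
        then have "finite {j \<in> I. y j \<noteq> \<zero>\<^bsub>M\<^esub>}"
          using insert.prems by (auto simp: direct_sum_copies_simps intro: finite_subset)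
        then show ?thesis using x by (auto simp: direct_sum_copies_simps y_def)
      qed
      have "{j \<in> I. y j \<noteq> \<zero>\<^bsub>M\<^esub>} \<subseteq> F" using insert.prems by (auto simp: y_def)
      then have qy: "q y \<in> L" by (rule insert.IH[OF y])
      have "x = e (x i) \<oplus>\<^bsub>?D\<^esub> y"
      proof (rule extensionalityI[of _ I])
        fix j assume "j \<in> I"
        then show "x j = (e (x i) \<oplus>\<^bsub>?D\<^esub> y) j"
          using PiE_mem[OF x, of j] xi by (simp add: direct_sum_copies_simps e_def y_def)
      qed (use x in \<open>simp_all add: direct_sum_copies_simps PiE_iff\<close>)
      then have "q x = q (e (x i) \<oplus>\<^bsub>?D\<^esub> y)" by (rule arg_cong)
      also have "\<dots> = q (e (x i)) \<oplus>\<^bsub>X\<^esub> q y" by (rule lin_add[OF q(1) e_closed[OF xi] y])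
      finally show ?thesis using l(4)[OF trace[OF e xi] qy] by simp
    qed
  qed
  have "q x \<in> L" if "x \<in> carrier ?D" for x
    by (rule main[OF _ that subset_refl]) (use that in \<open>simp add: direct_sum_copies_simps\<close>)
  then have "q ` carrier ?D \<subseteq> L" by blast
  then show ?thesis using q(2) l(1) by blast
qed

text \<open>Lifting along g is the surjectivity of Hom(M,B) \<rightarrow> Hom(M,C) for the sequence
  0 \<rightarrow> Ker g \<rightarrow> B \<rightarrow> C \<rightarrow> 0; the kernel lies in
  \<sigma>[M] because it is a submodule of \<open>B\<close>.\<close>

lemma projective_lift:
  fixes M B C :: "('r, 'u) module"
  assumes M: "left_module R M" and proj: "projective_in_sigma R M"
    and B: "B \<in> sigma_cat R M" and C: "C \<in> sigma_cat R M"
    and g: "lin R B C g" "g ` carrier B = carrier C" and h: "lin R M C h"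
  obtains k where "lin R M B k" "\<And>m. m \<in> carrier M \<Longrightarrow> g (k m) = h m"
proof -
  have lB: "left_module R B" and lC: "left_module R C" using B C by (auto simp: sigma_cat_def)
  interpret g: linear_map R B C g using lB lC g by (intro linear_mapI)
  let ?A = "B\<lparr>carrier := Ker B C g\<rparr>"
  have A: "?A \<in> sigma_cat R M" by (rule submodule_in_sigma[OF B g.submodule_kernel])
  have K: "Ker B C g \<subseteq> carrier B" by (auto simp: Ker_def)
  then have "lin R ?A B (\<lambda>x. x)" by (auto simp: lin_def)
  then have "restrict (\<lambda>x. x) (Ker B C g) \<in> Hom R ?A B"
    using restrict_in_Hom[of R ?A B "\<lambda>x. x"] A by (auto simp: sigma_cat_def)
  moreover have "restrict g (carrier B) \<in> Hom R B C" by (rule restrict_in_Hom[OF g(1) lB])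
  ultimately have "short_exact R ?A B C (restrict (\<lambda>x. x) (Ker B C g)) (restrict g (carrier B))"
    using g(2) K by (auto simp: short_exact_def Mono_hom_def Epi_hom_def inj_on_def Ker_def)
  then have "(\<lambda>k. compose (carrier M) (restrict g (carrier B)) k) ` Hom R M B = Hom R M C"
    using proj A B C unfolding projective_in_sigma_def by blast
  moreover have "restrict h (carrier M) \<in> Hom R M C" by (rule restrict_in_Hom[OF h M])
  ultimately obtain k where k: "k \<in> Hom R M B"
    "restrict h (carrier M) = compose (carrier M) (restrict g (carrier B)) k" by blast
  have "g (k m) = h m" if "m \<in> carrier M" for m
    using fun_cong[OF k(2), of m] that k(1) by (auto simp: Hom_iff_lin compose_def lin_closed)
  then show ?thesis using k(1) that by (auto simp: Hom_iff_lin)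
qed

text \<open>Zorn's lemma: if the union of a chain of proper submodules were all of \<open>M\<close>,
  the finite generating set would already lie in one member, which would then not be proper.\<close>

lemma maximal_submodule_exists:
  assumes "left_module R M" "finitely_generated R M" "submodule K R M" "K \<noteq> carrier M"
  obtains P where "submodule P R M" "K \<subseteq> P" "P \<noteq> carrier M"
    "\<And>L. submodule L R M \<Longrightarrow> P \<subseteq> L \<Longrightarrow> L = P \<or> L = carrier M"
proof -
  interpret M: left_module R M by fact
  obtain S where S: "finite S" "S \<subseteq> carrier M" "submodule_span R M S = carrier M"
    using assms(2) unfolding finitely_generated_def by blast
  let ?A = "{N. submodule N R M \<and> K \<subseteq> N \<and> N \<noteq> carrier M}"
  have "\<exists>P\<in>?A. \<forall>X\<in>?A. P \<subseteq> X \<longrightarrow> X = P"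
  proof (rule subset_Zorn_nonempty)
    show "?A \<noteq> {}" using assms by blast
    fix C assume C: "C \<noteq> {}" "subset.chain ?A C"
    then have c: "N \<in> ?A" if "N \<in> C" for N using that by (auto simp: subset_chain_def)
    have lin: "N \<subseteq> L \<or> L \<subseteq> N" if "N \<in> C" "L \<in> C" for N L
      using that C(2) by (auto simp: subset_chain_def)
    have sub: "submodule (\<Union>C) R M"
      by (rule M.submodule_Union_chain) (use C(1) c lin in auto)
    moreover have "\<Union>C \<noteq> carrier M"
    proof
      assume eq: "\<Union>C = carrier M"
      obtain N where N: "N \<in> C" "S \<subseteq> N"
        using finite_subset_Union_chain[OF S(1) _ C] S(2) eq by auto
      then have "carrier M \<subseteq> N" using S(3) c[OF N(1)] unfolding submodule_span_def by blast
      then show False using c[OF N(1)] M.submoduleD(1)[of N] by blast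
    qed
    ultimately show "\<Union>C \<in> ?A" using C(1) c by blast
  qed
  then obtain P where "P \<in> ?A" "\<forall>X\<in>?A. P \<subseteq> X \<longrightarrow> X = P" by blast
  then show ?thesis using that[of P] by blast
qed

text \<open>Cosets would form a module over the type \<open>'u set\<close>, whereas
  \<open>sigma_cat\<close> consists of modules over \<open>'u\<close>. The carrier therefore
  consists of one chosen representative for each coset, and p sends an element to its
  representative.\<close>

lemma quotient_module_exists:
  fixes M :: "('r, 'u) module"
  assumes "left_module R M" and P: "submodule P R M"
  obtains Q :: "('r, 'u) module" and p where "left_module R Q" "lin R M Q p"
    "p ` carrier M = carrier Q" "\<And>m. m \<in> carrier M \<Longrightarrow> p m = \<zero>\<^bsub>Q\<^esub> \<longleftrightarrow> m \<in> P"
proof -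
  interpret M: left_module R M by fact
  note d = M.submoduleD[OF P]
  define p where "p m = (SOME y. y \<in> carrier M \<and> m \<ominus>\<^bsub>M\<^esub> y \<in> P)" for m
  have p: "p m \<in> carrier M \<and> m \<ominus>\<^bsub>M\<^esub> p m \<in> P" if "m \<in> carrier M" for m
    unfolding p_def by (rule someI[of _ m]) (use that d in \<open>simp add: M.M.r_neg a_minus_def\<close>)
  \<comment> \<open>Congruent elements put the same predicate under \<open>SOME\<close>, hence
    receive the same representative.\<close>
  have cong: "p m = p n" if "m \<in> carrier M" "n \<in> carrier M" "m \<ominus>\<^bsub>M\<^esub> n \<in> P" for m n
  proof -
    note mn = that
    have "m \<ominus>\<^bsub>M\<^esub> y \<in> P \<longleftrightarrow> n \<ominus>\<^bsub>M\<^esub> y \<in> P" if y: "y \<in> carrier M" for y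
    proof -
      have 1: "m \<ominus>\<^bsub>M\<^esub> y = (m \<ominus>\<^bsub>M\<^esub> n) \<oplus>\<^bsub>M\<^esub> (n \<ominus>\<^bsub>M\<^esub> y)" and 2: "n \<ominus>\<^bsub>M\<^esub> y = (m \<ominus>\<^bsub>M\<^esub> y) \<ominus>\<^bsub>M\<^esub> (m \<ominus>\<^bsub>M\<^esub> n)"
        using mn(1,2) y
        by (simp_all add: a_minus_def M.M.minus_add M.M.a_ac M.M.r_neg1 M.M.r_neg2 M.M.r_neg M.M.l_neg)
      show ?thesis using 1 2 d(4,5) mn(3) by metis
    qed
    then show ?thesis unfolding p_def by (metis (no_types, lifting))
  qed
  have conv: "m \<ominus>\<^bsub>M\<^esub> n \<in> P" if "m \<in> carrier M" "n \<in> carrier M" "p m = p n" for m n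
  proof -
    have "p n \<oplus>\<^bsub>M\<^esub> (\<ominus>\<^bsub>M\<^esub> n \<oplus>\<^bsub>M\<^esub> \<ominus>\<^bsub>M\<^esub> p n) = \<ominus>\<^bsub>M\<^esub> n"
      using that p[of n] by (simp add: M.M.a_lcomm[of "p n" "\<ominus>\<^bsub>M\<^esub> n"] M.M.r_neg)
    then have "m \<ominus>\<^bsub>M\<^esub> n = (m \<ominus>\<^bsub>M\<^esub> p m) \<ominus>\<^bsub>M\<^esub> (n \<ominus>\<^bsub>M\<^esub> p n)"
      using that p[of m] p[of n]
      by (simp add: a_minus_def M.M.minus_add M.M.a_ac M.M.r_neg1 M.M.r_neg2 M.M.r_neg M.M.l_neg)
    then show ?thesis using p that d(5) by metis
  qed
  have pp: "p (p m) = p m" if "m \<in> carrier M" for m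
    using cong[of m "p m"] p that by simp
  define Q :: "('r, 'u) module" where "Q = \<lparr>carrier = p ` carrier M, mult = undefined, one = undefined, zero = p \<zero>\<^bsub>M\<^esub>,
    add = (\<lambda>x y. p (x \<oplus>\<^bsub>M\<^esub> y)), smult = (\<lambda>r x. p (r \<odot>\<^bsub>M\<^esub> x))\<rparr>"
  have pc [simp]: "p m \<in> carrier M" if "m \<in> carrier M" for m using p that by blast
  have add: "p (p x \<oplus>\<^bsub>M\<^esub> p y) = p (x \<oplus>\<^bsub>M\<^esub> y)" if "x \<in> carrier M" "y \<in> carrier M" for x y
  proof (rule sym, rule cong)
    have "(x \<oplus>\<^bsub>M\<^esub> y) \<ominus>\<^bsub>M\<^esub> (p x \<oplus>\<^bsub>M\<^esub> p y) = (x \<ominus>\<^bsub>M\<^esub> p x) \<oplus>\<^bsub>M\<^esub> (y \<ominus>\<^bsub>M\<^esub> p y)"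
      using that by (simp add: a_minus_def M.M.minus_add M.M.a_ac)
    then show "(x \<oplus>\<^bsub>M\<^esub> y) \<ominus>\<^bsub>M\<^esub> (p x \<oplus>\<^bsub>M\<^esub> p y) \<in> P" using that p d(4) by simp
  qed (use that in auto)
  have smult: "p (r \<odot>\<^bsub>M\<^esub> p x) = p (r \<odot>\<^bsub>M\<^esub> x)" if "r \<in> carrier R" "x \<in> carrier M" for r x
  proof (rule sym, rule cong)
    have "(r \<odot>\<^bsub>M\<^esub> x) \<ominus>\<^bsub>M\<^esub> (r \<odot>\<^bsub>M\<^esub> p x) = r \<odot>\<^bsub>M\<^esub> (x \<ominus>\<^bsub>M\<^esub> p x)"
      using that by (simp add: a_minus_def M.smult_r_distr M.smult_minus)
    then show "(r \<odot>\<^bsub>M\<^esub> x) \<ominus>\<^bsub>M\<^esub> (r \<odot>\<^bsub>M\<^esub> p x) \<in> P" using that p d(7) by simp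
  qed (use that in auto)
  have Qs: "carrier Q = p ` carrier M" "\<zero>\<^bsub>Q\<^esub> = p \<zero>\<^bsub>M\<^esub>" "\<And>x y. x \<oplus>\<^bsub>Q\<^esub> y = p (x \<oplus>\<^bsub>M\<^esub> y)"
    "\<And>r x. r \<odot>\<^bsub>Q\<^esub> x = p (r \<odot>\<^bsub>M\<^esub> x)"
    by (simp_all add: Q_def)
  have add': "p (x \<oplus>\<^bsub>M\<^esub> p y) = p (x \<oplus>\<^bsub>M\<^esub> y)" "p (p x \<oplus>\<^bsub>M\<^esub> y) = p (x \<oplus>\<^bsub>M\<^esub> y)"
    if "x \<in> carrier M" "y \<in> carrier M" for x y
    using add[of x "p y"] add[of "p x" y] add[of x y] that by (simp_all add: pp)
  have smult_add: "p (a \<odot>\<^bsub>M\<^esub> p x \<oplus>\<^bsub>M\<^esub> b \<odot>\<^bsub>M\<^esub> p x) = p (a \<odot>\<^bsub>M\<^esub> x \<oplus>\<^bsub>M\<^esub> b \<odot>\<^bsub>M\<^esub> x)"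
    and smult_smult: "p (a \<odot>\<^bsub>M\<^esub> (b \<odot>\<^bsub>M\<^esub> p x)) = p (a \<odot>\<^bsub>M\<^esub> (b \<odot>\<^bsub>M\<^esub> x))"
    if "a \<in> carrier R" "b \<in> carrier R" "x \<in> carrier M" for a b x
    using that add[of "a \<odot>\<^bsub>M\<^esub> p x" "b \<odot>\<^bsub>M\<^esub> p x"] add[of "a \<odot>\<^bsub>M\<^esub> x" "b \<odot>\<^bsub>M\<^esub> x"]
      smult[of a "b \<odot>\<^bsub>M\<^esub> p x"] smult[of a "b \<odot>\<^bsub>M\<^esub> x"] smult[of a x] smult[of b x] by simp_all
  have "abelian_group Q"
  proof (rule abelian_groupI)
    fix x assume "x \<in> carrier Q"
    then obtain m where "m \<in> carrier M" "x = p m" by (auto simp: Qs)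
    then show "\<exists>y\<in>carrier Q. y \<oplus>\<^bsub>Q\<^esub> x = \<zero>\<^bsub>Q\<^esub>"
      by (intro bexI[of _ "p (\<ominus>\<^bsub>M\<^esub> m)"]) (auto simp: Qs add M.M.l_neg)
  qed (auto simp: Qs add add' pp, (simp add: M.M.a_ac)+)
  then have "left_module R Q"
    using M.R.ring_axioms
    by (intro left_module.intro left_module_axioms.intro)
      (auto simp: Qs add smult smult_add smult_smult pp M.smult_l_distr M.smult_r_distr M.smult_assoc1)
  moreover have "lin R M Q p"
    by (rule linI) (auto simp: Qs add smult)
  moreover have "p m = \<zero>\<^bsub>Q\<^esub> \<longleftrightarrow> m \<in> P" if "m \<in> carrier M" for m
  proof -
    have "\<ominus>\<^bsub>M\<^esub> \<zero>\<^bsub>M\<^esub> = \<zero>\<^bsub>M\<^esub>" by (rule M.M.minus_equality) simp_all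
    then have "m \<ominus>\<^bsub>M\<^esub> \<zero>\<^bsub>M\<^esub> = m" using that by (simp add: M.M.minus_eq)
    then show ?thesis
      using cong[of m "\<zero>\<^bsub>M\<^esub>"] conv[of m "\<zero>\<^bsub>M\<^esub>"] that Qs(2) by auto
  qed
  ultimately show ?thesis using that[of Q p] Qs(1) by blast
qed

section \<open>Fully invariant submodules, factorization, extension, chains\<close>

lemma fully_invariantD:
  assumes "left_module R X" "fully_invariant R X N" "lin R X X f" "x \<in> N"
  shows "f x \<in> N"
proof -
  have N: "submodule N R X" "restrict f (carrier X) ` N \<subseteq> N"
    using assms(2) restrict_in_Hom[OF assms(3,1)] unfolding fully_invariant_def by blast+
  have "x \<in> carrier X" by (rule left_module.submoduleD(3)[OF assms(1) N(1) assms(4)])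
  then show ?thesis using N(2) assms(4) by (auto simp: image_subset_iff)
qed

lemma fully_invariantI:
  assumes "submodule N R X" "\<And>f x. lin R X X f \<Longrightarrow> x \<in> N \<Longrightarrow> f x \<in> N"
  shows "fully_invariant R X N"
  using assms by (auto simp: fully_invariant_def Hom_iff_lin)

text \<open>Since \<open>ker\<close> places the kernel of x inside that of p, the map p is constant
  on the fibres of x, and any preimage may be used to define f. Combined with injectivity this
  solves f x = p with f defined on all of \<open>B\<close>.\<close>

lemma factor_through_image:
  assumes "left_module R A" "left_module R B" "left_module R C" "lin R A B x" "lin R A C p"
    and ker: "\<And>a. a \<in> carrier A \<Longrightarrow> x a = \<zero>\<^bsub>B\<^esub> \<Longrightarrow> p a = \<zero>\<^bsub>C\<^esub>"
  obtains f where "lin R (B\<lparr>carrier := x ` carrier A\<rparr>) C f" "\<And>a. a \<in> carrier A \<Longrightarrow> f (x a) = p a"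
proof -
  interpret x: linear_map R A B x using assms by (intro linear_mapI)
  interpret p: linear_map R A C p using assms by (intro linear_mapI)
  have eq: "p a = p b" if ab: "a \<in> carrier A" "b \<in> carrier A" "x a = x b" for a b
  proof -
    have "x (a \<ominus>\<^bsub>A\<^esub> b) = \<zero>\<^bsub>B\<^esub>"
      using x.minus[OF ab(1,2)] x.B.M.r_neg[of "x b"] ab by (simp add: a_minus_def)
    then have "p (a \<ominus>\<^bsub>A\<^esub> b) = \<zero>\<^bsub>C\<^esub>" using ker ab by simp
    then have 0: "p a \<oplus>\<^bsub>C\<^esub> \<ominus>\<^bsub>C\<^esub> p b = \<zero>\<^bsub>C\<^esub>" using p.minus[OF ab(1,2)] by (simp add: a_minus_def)
    show ?thesis using p.B.M.minus_equality[OF 0] ab by simp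
  qed
  define f where "f y = p (SOME a. a \<in> carrier A \<and> x a = y)" for y
  have f: "f (x a) = p a" if "a \<in> carrier A" for a
  proof -
    have "(SOME b. b \<in> carrier A \<and> x b = x a) \<in> carrier A \<and> x (SOME b. b \<in> carrier A \<and> x b = x a) = x a"
      by (rule someI[of _ a]) (simp add: that)
    then show ?thesis unfolding f_def using eq that by blast
  qed
  have "lin R (B\<lparr>carrier := x ` carrier A\<rparr>) C f"
  proof (rule linI)
    fix y z assume "y \<in> carrier (B\<lparr>carrier := x ` carrier A\<rparr>)" "z \<in> carrier (B\<lparr>carrier := x ` carrier A\<rparr>)"
    then obtain a b where ab: "a \<in> carrier A" "b \<in> carrier A" "y = x a" "z = x b" by auto
    then show "f (y \<oplus>\<^bsub>B\<lparr>carrier := x ` carrier A\<rparr>\<^esub> z) = f y \<oplus>\<^bsub>C\<^esub> f z"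
      using f[of "a \<oplus>\<^bsub>A\<^esub> b"] by (simp add: x.add p.add f)
  next
    fix r y assume r: "r \<in> carrier R" "y \<in> carrier (B\<lparr>carrier := x ` carrier A\<rparr>)"
    then obtain a where a: "a \<in> carrier A" "y = x a" by auto
    then show "f (r \<odot>\<^bsub>B\<lparr>carrier := x ` carrier A\<rparr>\<^esub> y) = r \<odot>\<^bsub>C\<^esub> f y"
      using f[of "r \<odot>\<^bsub>A\<^esub> a"] r(1) by (simp add: x.smult p.smult f)
  qed (auto simp: f)
  then show ?thesis using f that by blast
qed

lemma injective_extend:
  fixes M E X :: "('r, 'u) module"
  assumes inj: "injective_in_sigma R M E" and X: "X \<in> sigma_cat R M" and T: "submodule T R X"
    and g: "lin R (X\<lparr>carrier := T\<rparr>) E g"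
  obtains h where "lin R X E h" "\<And>x. x \<in> T \<Longrightarrow> h x = g x"
proof -
  interpret X: left_module R X using X by (simp add: sigma_cat_def)
  have TX: "T \<subseteq> carrier X" by (rule X.submoduleD(1)[OF T])
  have lT: "left_module R (X\<lparr>carrier := T\<rparr>)" by (rule X.left_module_submodule[OF T])
  have TS: "X\<lparr>carrier := T\<rparr> \<in> sigma_cat R M" by (rule submodule_in_sigma[OF X T])
  have "lin R (X\<lparr>carrier := T\<rparr>) X (\<lambda>x. x)" by (rule lin_subdomain[OF lin_id TX])
  then have i: "restrict (\<lambda>x. x) T \<in> Mono_hom R (X\<lparr>carrier := T\<rparr>) X"
    using restrict_in_Hom[OF _ lT] by (fastforce simp: Mono_hom_def inj_on_def)
  have "restrict g T \<in> Hom R (X\<lparr>carrier := T\<rparr>) E"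
    using restrict_in_Hom[OF g lT] by simp
  then obtain h where h: "h \<in> Hom R X E"
    "compose (carrier (X\<lparr>carrier := T\<rparr>)) h (restrict (\<lambda>x. x) T) = restrict g T"
    using inj X TS i unfolding injective_in_sigma_def by blast
  have "h x = g x" if "x \<in> T" for x
    using fun_cong[OF h(2), of x] that by (simp add: compose_def)
  then show ?thesis using that h(1) by (auto simp: Hom_iff_lin)
qed

text \<open>The \<open>L n\<close> turn out to be independent, against finite uniform dimension. The
  point is that a sum of the earlier ones meets \<open>A n\<close> only in zero, while all later
  ones lie in \<open>A (Suc n)\<close>.\<close>

lemma no_descending_chain_of_inessentials:
  assumes "left_module R M" and fud: "finite_uniform_dimension R M"
    and A: "\<And>n. submodule (A n) R M" "\<And>n. A (Suc n) \<subseteq> A n"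
    and L: "\<And>n. submodule (L n) R M" "\<And>n. L n \<subseteq> A n" "\<And>n. L n \<noteq> {\<zero>\<^bsub>M\<^esub>}"
      "\<And>n x. x \<in> L n \<Longrightarrow> x \<in> A (Suc n) \<Longrightarrow> x = \<zero>\<^bsub>M\<^esub>"
  shows False
proof -
  interpret M: left_module R M by fact
  \<comment> \<open>\<open>W n\<close> is L 0 + ... + L (n - 1), the sum of the terms strictly
    before n.\<close>
  define W where "W = rec_nat {\<zero>\<^bsub>M\<^esub>} (\<lambda>n w. w <+>\<^bsub>M\<^esub> L n)"
  have W0: "W 0 = {\<zero>\<^bsub>M\<^esub>}" and WS: "W (Suc n) = W n <+>\<^bsub>M\<^esub> L n" for n
    by (simp_all add: W_def)
  have W: "submodule (W n) R M" for n
    by (induction n) (simp_all add: W0 WS M.submodule_zero M.submodule_sum L(1))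
  have W_mono: "W i \<subseteq> W j" if "i \<le> j" for i j
    by (rule lift_Suc_mono_le[OF _ that]) (simp add: WS M.sum_superset(1)[OF W L(1)])
  have LW: "L j \<subseteq> W i" if "j < i" for i j
    using M.sum_superset(2)[OF W[of j] L(1)[of j]] W_mono[of "Suc j" i] that by (simp add: WS)
  have A_anti: "A j \<subseteq> A i" if "i \<le> j" for i j
    by (rule lift_Suc_antimono_le[of A, OF A(2) that])
  \<comment> \<open>Write x = w + l with w in \<open>W n\<close> and l in \<open>L n\<close>. As x
    and l lie in \<open>A n\<close>, so does w, and w = 0 by induction; then x = l lies in
    \<open>L n\<close> and in \<open>A (Suc n)\<close>.\<close>
  have WA: "x = \<zero>\<^bsub>M\<^esub>" if "x \<in> W n" "x \<in> A n" for n x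
    using that
  proof (induction n arbitrary: x)
    case 0
    then show ?case by (simp add: W0)
  next
    case (Suc n)
    from Suc.prems(1) obtain w l where wl: "w \<in> W n" "l \<in> L n" "x = w \<oplus>\<^bsub>M\<^esub> l"
      by (auto simp: WS set_add_def')
    have c: "w \<in> carrier M" "l \<in> carrier M"
      using wl M.submoduleD(3)[OF W] M.submoduleD(3)[OF L(1)] by blast+
    have "x \<in> A n" "l \<in> A n" using Suc.prems(2) A(2) L(2) wl by blast+
    then have "x \<ominus>\<^bsub>M\<^esub> l \<in> A n" by (rule M.submoduleD(5)[OF A(1)])
    moreover have "x \<ominus>\<^bsub>M\<^esub> l = w"
      using c unfolding wl(3) a_minus_def by (simp add: M.M.a_assoc M.M.r_neg)
    ultimately have "w = \<zero>\<^bsub>M\<^esub>" using Suc.IH wl(1) by simp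
    then have "x = l" using wl(3) c by simp
    then show ?case using L(4) wl(2) Suc.prems(2) by blast
  qed
  have "L i \<inter> submodule_span R M (\<Union>j\<in>UNIV - {i}. L j) \<subseteq> {\<zero>\<^bsub>M\<^esub>}" for i
  proof
    fix x assume x: "x \<in> L i \<inter> submodule_span R M (\<Union>j\<in>UNIV - {i}. L j)"
    \<comment> \<open>Terms before i lie in \<open>W i\<close>, terms after i in
      \<open>A (Suc i)\<close>. So an element x of \<open>L i\<close> in the span of the others is w
      + y, where w = x - y belongs to both \<open>W i\<close> and \<open>A i\<close> and vanishes;
      this leaves x = y in \<open>A (Suc i)\<close>.\<close>
    have "L j \<subseteq> W i <+>\<^bsub>M\<^esub> A (Suc i)" if "j \<noteq> i" for j
    proof (cases "j < i")
      case True
      then show ?thesis using LW M.sum_superset(1)[OF W A(1)] by blast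
    next
      case False
      then have "L j \<subseteq> A (Suc i)" using that L(2)[of j] A_anti[of "Suc i" j] by auto
      then show ?thesis using M.sum_superset(2)[OF W A(1)] by blast
    qed
    then have "submodule_span R M (\<Union>j\<in>UNIV - {i}. L j) \<subseteq> W i <+>\<^bsub>M\<^esub> A (Suc i)"
      unfolding submodule_span_def using M.submodule_sum[OF W A(1)] by (intro Inter_lower) auto
    then obtain w y where wy: "w \<in> W i" "y \<in> A (Suc i)" "x = w \<oplus>\<^bsub>M\<^esub> y"
      using x by (auto simp: set_add_def')
    have c: "w \<in> carrier M" "y \<in> carrier M"
      using wy M.submoduleD(3)[OF W] M.submoduleD(3)[OF A(1)] by blast+
    have "x \<in> A i" "y \<in> A i" using x A(2) L(2) wy by blast+
    then have "x \<ominus>\<^bsub>M\<^esub> y \<in> A i" by (rule M.submoduleD(5)[OF A(1)])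
    moreover have "x \<ominus>\<^bsub>M\<^esub> y = w"
      using c unfolding wy(3) a_minus_def by (simp add: M.M.a_assoc M.M.r_neg)
    ultimately have "w = \<zero>\<^bsub>M\<^esub>" using WA wy(1) by simp
    then have "x = y" using wy(3) c by simp
    then have "x = \<zero>\<^bsub>M\<^esub>" using L(4) wy(2) x by blast
    then show "x \<in> {\<zero>\<^bsub>M\<^esub>}" by simp
  qed
  moreover have "\<zero>\<^bsub>M\<^esub> \<in> L i \<inter> submodule_span R M (\<Union>j\<in>UNIV - {i}. L j)" for i
    using M.submoduleD(2)[OF L(1)] M.submoduleD(2) by (simp add: submodule_span_def)
  ultimately have "L i \<inter> submodule_span R M (\<Union>j\<in>UNIV - {i}. L j) = {\<zero>\<^bsub>M\<^esub>}" for i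
    by blast
  then have "independent_submodules R M UNIV L"
    using L(1) by (simp add: independent_submodules_def)
  then show False using fud L(3) unfolding finite_uniform_dimension_def by blast
qed

subsection \<open>Nonsingularity\<close>

text \<open>For \<open>M = R\<close> the maps h are r \<mapsto> r x and their kernels are
  annihilators of elements, so this is the usual nonsingularity of \<open>X\<close>. Vanishing is
  asked on the carrier only, because \<open>lin\<close> does not see other values.\<close>

definition nonsingular_over :: "('r, 'k) ring_scheme \<Rightarrow> ('r, 'a) module \<Rightarrow> ('r, 'b) module \<Rightarrow> bool" where
  "nonsingular_over R M X \<longleftrightarrow>
     (\<forall>h. lin R M X h \<and> essential_submodule R M (Ker M X h) \<longrightarrow> (\<forall>m\<in>carrier M. h m = \<zero>\<^bsub>X\<^esub>))"

locale progenerator_module =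
  fixes R :: "('r, 'k) ring_scheme" and M :: "('r, 'u) module"
  assumes left_module: "left_module R M" and progenerator: "progenerator_in_sigma R M"

sublocale progenerator_module \<subseteq> left_module R M by (rule left_module)

context progenerator_module
begin

lemma finitely_generated: "finitely_generated R M"
  and projective: "projective_in_sigma R M"
  and generator: "generator_in_sigma R M"
  using progenerator by (simp_all add: progenerator_in_sigma_def)

lemma linear_map_from: "left_module R X \<Longrightarrow> lin R M X f \<Longrightarrow> linear_map R M X f"
  by (rule linear_mapI[OF left_module])

text \<open>\<open>A\<close> is itself a member of \<sigma>[M] and so is generated by
  \<open>M\<close>. The maps are stated with codomain \<open>X\<close> and values in
  \<open>A\<close>, which lets them be composed with maps on \<open>X\<close>.\<close>

lemma trace_submodule:
  assumes X: "X \<in> sigma_cat R M" and A: "submodule A R X" and B: "submodule B R X" "B \<subseteq> A"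
    and tr: "\<And>s m. lin R M X s \<Longrightarrow> (\<And>m. m \<in> carrier M \<Longrightarrow> s m \<in> A) \<Longrightarrow> m \<in> carrier M \<Longrightarrow> s m \<in> B"
  shows "B = A"
proof -
  interpret X: left_module R X using X by (simp add: sigma_cat_def)
  have "submodule B R (X\<lparr>carrier := A\<rparr>)" using X.submodule_of_submodule[OF A] B by blast
  then have "B = carrier (X\<lparr>carrier := A\<rparr>)"
  proof (rule generator_trace[OF left_module generator submodule_in_sigma[OF X A]])
    fix f x assume f: "lin R M (X\<lparr>carrier := A\<rparr>) f" and x: "x \<in> carrier M"
    show "f x \<in> B"
    proof (rule tr[OF _ _ x])
      show "lin R M X f" by (rule lin_from_subcodomain[OF f X.submoduleD(1)[OF A]])
      show "f m \<in> A" if "m \<in> carrier M" for m using lin_closed[OF f that] by simp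
    qed
  qed
  then show ?thesis by simp
qed

text \<open>By \<open>ess\<close> the submodule Ker f \<inter> A is essential in \<open>A\<close>.
  Nonsingularity speaks of maps on \<open>M\<close>, not on \<open>A\<close>, so s : M \<rightarrow>
  A is put in front: the kernel of f s is the preimage of an essential submodule, hence f s = 0, and
  \<open>A\<close> is covered by the images of such s.\<close>

lemma nonsingular_restrict:
  assumes X: "left_module R X" "nonsingular_over R M X" and f: "lin R M X f" and A: "submodule A R M"
    and ess: "\<And>L. submodule L R M \<Longrightarrow> L \<subseteq> A \<Longrightarrow> (\<And>x. x \<in> L \<Longrightarrow> f x = \<zero>\<^bsub>X\<^esub> \<Longrightarrow> x = \<zero>\<^bsub>M\<^esub>) \<Longrightarrow> L \<subseteq> {\<zero>\<^bsub>M\<^esub>}"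
    and a: "a \<in> A"
  shows "f a = \<zero>\<^bsub>X\<^esub>"
proof -
  interpret f: linear_map R M X f by (rule linear_map_from[OF X(1) f])
  let ?B = "Ker M X f \<inter> A"
  have B: "submodule ?B R M" by (rule submodule_Int[OF f.submodule_kernel A])
  have lA: "left_module R (M\<lparr>carrier := A\<rparr>)" by (rule left_module_submodule[OF A])
  have ess': "essential_submodule R (M\<lparr>carrier := A\<rparr>) ?B"
  proof (rule essentialI[OF _ _ lA])
    show "submodule ?B R (M\<lparr>carrier := A\<rparr>)" using submodule_of_submodule[OF A] B by blast
    fix L assume L: "submodule L R (M\<lparr>carrier := A\<rparr>)" and
      0: "\<And>x. x \<in> ?B \<Longrightarrow> x \<in> L \<Longrightarrow> x = \<zero>\<^bsub>M\<lparr>carrier := A\<rparr>\<^esub>"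
    have L': "submodule L R M" "L \<subseteq> A" using L submodule_of_submodule[OF A] by blast+
    have "x = \<zero>\<^bsub>M\<^esub>" if "x \<in> L" "f x = \<zero>\<^bsub>X\<^esub>" for x
      using 0[of x] that L'(2) submoduleD(3)[OF L'(1)] by (auto simp: Ker_def)
    then show "L \<subseteq> {\<zero>\<^bsub>M\<lparr>carrier := A\<rparr>\<^esub>}" using ess[OF L'] by simp
  qed
  have "?B = A"
  proof (rule trace_submodule[OF self_in_sigma[OF left_module] A B])
    fix s m assume s: "lin R M M s" "\<And>m. m \<in> carrier M \<Longrightarrow> s m \<in> A" and m: "m \<in> carrier M"
    interpret s: linear_map R M "M\<lparr>carrier := A\<rparr>" s
      by (rule linear_map_from[OF lA lin_subcodomain[OF s]])
    have fs: "lin R M X (\<lambda>m. f (s m))" by (rule lin_comp[OF s(1) f])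
    have "{x \<in> carrier M. s x \<in> ?B} = Ker M X (\<lambda>m. f (s m))"
      using s(2) lin_closed[OF s(1)] by (auto simp: Ker_def)
    then have "essential_submodule R M (Ker M X (\<lambda>m. f (s m)))"
      using s.essential_preimage[OF ess'] by simp
    then have "f (s m) = \<zero>\<^bsub>X\<^esub>" using X(2) fs m unfolding nonsingular_over_def by blast
    then show "s m \<in> ?B" using s(2)[OF m] lin_closed[OF s(1) m] by (simp add: Ker_def)
  qed blast
  then show ?thesis using a by (auto simp: Ker_def)
qed

text \<open>If a finite G is not enough, some f in \<open>F\<close> is nonzero on the common kernel
  of G, and \<open>nonsingular_restrict\<close> read backwards yields a nonzero L in that kernel on
  which f is injective. Adding f to G and repeating produces a descending chain of common kernels
  that finite uniform dimension forbids.\<close>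

lemma finite_common_kernel:
  assumes X: "left_module R X" "nonsingular_over R M X" and fud: "finite_uniform_dimension R M"
    and F: "\<And>f. f \<in> F \<Longrightarrow> lin R M X f"
  obtains G where "finite G" "G \<subseteq> F"
    "\<And>m f. m \<in> carrier M \<Longrightarrow> (\<And>g. g \<in> G \<Longrightarrow> g m = \<zero>\<^bsub>X\<^esub>) \<Longrightarrow> f \<in> F \<Longrightarrow> f m = \<zero>\<^bsub>X\<^esub>"
proof (rule ccontr)
  note main = that
  assume "\<not> thesis"
  then have no: "\<not> (\<forall>m f. m \<in> carrier M \<longrightarrow> (\<forall>g\<in>G. g m = \<zero>\<^bsub>X\<^esub>) \<longrightarrow> f \<in> F \<longrightarrow> f m = \<zero>\<^bsub>X\<^esub>)"
    if "finite G" "G \<subseteq> F" for G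
    using main[of G] that by blast
  define A where "A G = {m \<in> carrier M. \<forall>g\<in>G. g m = \<zero>\<^bsub>X\<^esub>}" for G
  have A: "submodule (A G) R M" if "G \<subseteq> F" for G
    unfolding A_def by (rule submodule_common_kernel[OF left_module X(1)]) (use F that in blast)
  have step: "\<exists>f L. f \<in> F \<and> submodule L R M \<and> L \<subseteq> A G \<and> L \<noteq> {\<zero>\<^bsub>M\<^esub>} \<and>
      (\<forall>x\<in>L. f x = \<zero>\<^bsub>X\<^esub> \<longrightarrow> x = \<zero>\<^bsub>M\<^esub>)" if G: "finite G" "G \<subseteq> F" for G
  proof -
    from no[OF G] obtain m f where m: "m \<in> carrier M" "\<And>g. g \<in> G \<Longrightarrow> g m = \<zero>\<^bsub>X\<^esub>"
      and f: "f \<in> F" "f m \<noteq> \<zero>\<^bsub>X\<^esub>" by blast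
    have "m \<in> A G" using m by (simp add: A_def)
    then have "\<exists>L. submodule L R M \<and> L \<subseteq> A G \<and> (\<forall>x\<in>L. f x = \<zero>\<^bsub>X\<^esub> \<longrightarrow> x = \<zero>\<^bsub>M\<^esub>) \<and> \<not> L \<subseteq> {\<zero>\<^bsub>M\<^esub>}"
      using nonsingular_restrict[OF X F[OF f(1)] A[OF G(2)]] f(2) by meson
    then show ?thesis using f(1) by blast
  qed
  \<comment> \<open>Both choices depend only on the finite set G: \<open>\<phi> G\<close> is the map
    to be added and \<open>\<Lambda> G\<close> the nonzero submodule on which it is
    injective.\<close>
  then obtain \<phi> \<Lambda> where \<phi>: "\<And>G. finite G \<Longrightarrow> G \<subseteq> F \<Longrightarrow> \<phi> G \<in> F \<and> submodule (\<Lambda> G) R M \<and> \<Lambda> G \<subseteq> A G \<and>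
      \<Lambda> G \<noteq> {\<zero>\<^bsub>M\<^esub>} \<and> (\<forall>x\<in>\<Lambda> G. \<phi> G x = \<zero>\<^bsub>X\<^esub> \<longrightarrow> x = \<zero>\<^bsub>M\<^esub>)"
    by metis
  define g where "g = rec_nat {} (\<lambda>n G. insert (\<phi> G) G)"
  have g0: "g 0 = {}" and gS: "g (Suc n) = insert (\<phi> (g n)) (g n)" for n
    by (simp_all add: g_def)
  have g: "finite (g n) \<and> g n \<subseteq> F" for n
  proof (induction n)
    case (Suc n)
    then show ?case using \<phi>[of "g n"] by (simp add: gS)
  qed (simp add: g0)
  have p: "submodule (\<Lambda> (g n)) R M" "\<Lambda> (g n) \<subseteq> A (g n)" "\<Lambda> (g n) \<noteq> {\<zero>\<^bsub>M\<^esub>}"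
    "\<And>x. x \<in> \<Lambda> (g n) \<Longrightarrow> \<phi> (g n) x = \<zero>\<^bsub>X\<^esub> \<Longrightarrow> x = \<zero>\<^bsub>M\<^esub>" for n
    using \<phi>[of "g n"] g[of n] by blast+
  show False
  proof (rule no_descending_chain_of_inessentials[OF left_module fud, of "\<lambda>n. A (g n)" "\<lambda>n. \<Lambda> (g n)"])
    show "submodule (A (g n)) R M" for n using A g by blast
    show "A (g (Suc n)) \<subseteq> A (g n)" for n by (auto simp: A_def gS)
    show "x = \<zero>\<^bsub>M\<^esub>" if "x \<in> \<Lambda> (g n)" "x \<in> A (g (Suc n))" for n x
      using p(4)[OF that(1)] that(2) by (simp add: A_def gS)
  qed (use p in auto)
qed

text \<open>Let f = j h be the map into the hull. Where f takes values in the copy of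
  \<open>M\<close>, it can be read as a map into \<open>M\<close>, and nonsingularity of
  \<open>M\<close> makes it vanish. So f(M) meets the essential copy of \<open>M\<close> only in
  zero, whence f(M) = 0.\<close>

lemma nonsingular_in_hull:
  assumes X: "left_module R X" and H: "left_module R H" and j: "lin R X H j" "inj_on j (carrier X)"
    and i: "lin R M H \<iota>" "inj_on \<iota> (carrier M)" "essential_submodule R H (\<iota> ` carrier M)"
    and ns: "nonsingular_over R M M"
  shows "nonsingular_over R M X"
  unfolding nonsingular_over_def
proof (intro allI impI ballI)
  fix h m assume h: "lin R M X h \<and> essential_submodule R M (Ker M X h)" and m: "m \<in> carrier M"
  interpret j: linear_map R X H j by (rule linear_mapI[OF X H j(1)])
  interpret h: linear_map R M X h by (rule linear_map_from[OF X]) (simp add: h)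
  interpret i: linear_map R M H \<iota> by (rule linear_map_from[OF H i(1)])
  let ?f = "\<lambda>m. j (h m)"
  have f: "lin R M H ?f" by (rule lin_comp[OF h.lin j(1)])
  interpret f: linear_map R M H ?f by (rule linear_map_from[OF H f])
  have inj0: "x = \<zero>\<^bsub>X\<^esub>" if "x \<in> carrier X" "j x = \<zero>\<^bsub>H\<^esub>" for x
    using j.inj_iff j(2) that by blast
  \<comment> \<open>\<open>\<kappa>\<close> is the inverse of the embedding \<open>\<iota>\<close>
    on its image; it exists because the identity of \<open>M\<close> factors through the injective
    map \<open>\<iota>\<close>.\<close>
  obtain \<kappa> where \<kappa>: "lin R (H\<lparr>carrier := \<iota> ` carrier M\<rparr>) M \<kappa>" "\<And>m. m \<in> carrier M \<Longrightarrow> \<kappa> (\<iota> m) = m"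
    using factor_through_image[OF left_module H left_module i(1) lin_id] i.inj_iff i(2) by blast
  let ?L = "{m \<in> carrier M. ?f m \<in> \<iota> ` carrier M}"
  have I: "submodule (\<iota> ` carrier M) R H" by (rule i.submodule_image[OF submodule_carrier])
  have L: "submodule ?L R M" by (rule f.submodule_preimage[OF I])
  have B: "submodule (Ker M H ?f \<inter> ?L) R M" by (rule submodule_Int[OF f.submodule_kernel L])
  have "Ker M H ?f \<inter> ?L = ?L"
  proof (rule trace_submodule[OF self_in_sigma[OF left_module] L B])
    fix s m assume s: "lin R M M s" "\<And>m. m \<in> carrier M \<Longrightarrow> s m \<in> ?L" and m: "m \<in> carrier M"
    interpret s: linear_map R M M s by (rule linear_map_from[OF left_module s(1)])
    let ?t = "\<lambda>m. \<kappa> (?f (s m))"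
    have "lin R M (H\<lparr>carrier := \<iota> ` carrier M\<rparr>) (\<lambda>m. ?f (s m))"
      by (rule lin_subcodomain[OF lin_comp[OF s(1) f]]) (use s(2) in blast)
    from lin_comp[OF this \<kappa>(1)] have t: "lin R M M ?t" .
    have \<kappa>0: "\<kappa> \<zero>\<^bsub>H\<^esub> = \<zero>\<^bsub>M\<^esub>" using \<kappa>(2)[of "\<zero>\<^bsub>M\<^esub>"] by simp
    have "essential_submodule R M {x \<in> carrier M. s x \<in> Ker M X h}"
      by (rule s.essential_preimage) (simp add: h)
    moreover have "submodule (Ker M M ?t) R M"
      by (rule linear_map.submodule_kernel[OF linear_map_from[OF left_module t]])
    moreover have "{x \<in> carrier M. s x \<in> Ker M X h} \<subseteq> Ker M M ?t"
      using \<kappa>0 by (auto simp: Ker_def)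
    ultimately have "essential_submodule R M (Ker M M ?t)"
      by (rule essential_superset[OF left_module])
    then have t0: "?t m = \<zero>\<^bsub>M\<^esub>" using ns t m unfolding nonsingular_over_def by blast
    obtain y where y: "y \<in> carrier M" "?f (s m) = \<iota> y" using s(2)[OF m] by blast
    then have "y = \<zero>\<^bsub>M\<^esub>" using t0 \<kappa>(2)[OF y(1)] by simp
    then have "?f (s m) = \<zero>\<^bsub>H\<^esub>" using y(2) by simp
    then show "s m \<in> Ker M H ?f \<inter> ?L" using s(2)[OF m] by (simp add: Ker_def)
  qed blast
  then have L0: "?L \<subseteq> Ker M H ?f" by (rule iffD2[OF inf.absorb_iff2])
  have "?f ` carrier M = {\<zero>\<^bsub>H\<^esub>}"
  proof (rule essentialD[OF H i(3) f.submodule_image[OF submodule_carrier]])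
    fix x assume "x \<in> \<iota> ` carrier M" "x \<in> ?f ` carrier M"
    then obtain m where m: "m \<in> carrier M" "x = ?f m" by blast
    then have "m \<in> ?L" using \<open>x \<in> \<iota> ` carrier M\<close> by simp
    then have "m \<in> Ker M H ?f" by (rule subsetD[OF L0])
    then show "x = \<zero>\<^bsub>H\<^esub>" using m(2) by (simp add: Ker_def)
  qed
  then have "?f m = \<zero>\<^bsub>H\<^esub>" using m by blast
  then show "h m = \<zero>\<^bsub>X\<^esub>" using inj0 m by simp
qed

text \<open>Enlarge \<open>K0\<close> to a complement K of N, so that N + K is essential, and extend
  the projection N + K \<rightarrow> N to h : E \<rightarrow> E. Nonsingularity turns h into an
  idempotent, so E is the direct sum of Ker h and h(E). The image contains N and is nonzero; hence
  Ker h = 0, and \<open>K0\<close> lies in Ker h.\<close>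

lemma indecomposable_injective_essential:
  assumes E: "injective_in_sigma R M E" "indecomposable R E" "nonsingular_over R M E"
    and N: "submodule N R E" "N \<noteq> {\<zero>\<^bsub>E\<^esub>}"
  shows "essential_submodule R E N"
proof -
  have ES: "E \<in> sigma_cat R M" using E(1) by (simp add: injective_in_sigma_def)
  then have lE: "left_module R E" by (simp add: sigma_cat_def)
  interpret E: left_module R E by (rule lE)
  show ?thesis
  proof (rule essentialI[OF N(1) _ lE])
    fix K0 assume K0: "submodule K0 R E" "\<And>x. x \<in> N \<Longrightarrow> x \<in> K0 \<Longrightarrow> x = \<zero>\<^bsub>E\<^esub>"
    let ?A = "{K. submodule K R E \<and> K0 \<subseteq> K \<and> (\<forall>x\<in>N. x \<in> K \<longrightarrow> x = \<zero>\<^bsub>E\<^esub>)}"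
    have "\<exists>P\<in>?A. \<forall>X\<in>?A. P \<subseteq> X \<longrightarrow> X = P"
    proof (rule subset_Zorn_nonempty)
      show "?A \<noteq> {}" using K0 by blast
      fix C assume C: "C \<noteq> {}" "subset.chain ?A C"
      then have c: "N \<in> ?A" if "N \<in> C" for N using that by (auto simp: subset_chain_def)
      have lin: "N \<subseteq> L \<or> L \<subseteq> N" if "N \<in> C" "L \<in> C" for N L
        using that C(2) by (auto simp: subset_chain_def)
      have "submodule (\<Union>C) R E"
        by (rule E.submodule_Union_chain) (use C(1) c lin in auto)
      then show "\<Union>C \<in> ?A" using C(1) c by blast
    qed
    then obtain K where KA: "K \<in> ?A" and "\<forall>X\<in>?A. K \<subseteq> X \<longrightarrow> X = K" by (rule bexE)
    note max = bspec[OF this(2), THEN mp]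
    have K: "submodule K R E" "K0 \<subseteq> K" "\<And>x. x \<in> N \<Longrightarrow> x \<in> K \<Longrightarrow> x = \<zero>\<^bsub>E\<^esub>"
      using KA by blast+
    let ?T = "N <+>\<^bsub>E\<^esub> K"
    have T: "submodule ?T R E" by (rule E.submodule_sum[OF N(1) K(1)])
    have Tess: "essential_submodule R E ?T"
    proof (rule essentialI[OF T _ lE])
      fix L assume L: "submodule L R E" "\<And>x. x \<in> ?T \<Longrightarrow> x \<in> L \<Longrightarrow> x = \<zero>\<^bsub>E\<^esub>"
      \<comment> \<open>If l = x - k with x in N, then l lies in both N + K and L and vanishes. So K
        + L still meets N only in zero, and maximality of K gives L \<subseteq> K.\<close>
      have "K <+>\<^bsub>E\<^esub> L \<in> ?A"
      proof (intro CollectI conjI ballI impI)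
        show "submodule (K <+>\<^bsub>E\<^esub> L) R E" by (rule E.submodule_sum[OF K(1) L(1)])
        show "K0 \<subseteq> K <+>\<^bsub>E\<^esub> L" using K(2) E.sum_superset(1)[OF K(1) L(1)] by blast
        fix x assume x: "x \<in> N" "x \<in> K <+>\<^bsub>E\<^esub> L"
        then obtain k l where kl: "k \<in> K" "l \<in> L" "x = k \<oplus>\<^bsub>E\<^esub> l" by (auto simp: set_add_def')
        have c: "k \<in> carrier E" "l \<in> carrier E" "x \<in> carrier E"
          using kl E.submoduleD(3)[OF K(1)] E.submoduleD(3)[OF L(1)] E.submoduleD(3)[OF N(1)] x by blast+
        have "l = x \<oplus>\<^bsub>E\<^esub> \<ominus>\<^bsub>E\<^esub> k"
          unfolding kl(3) using c by (simp add: E.M.a_comm[of k l] E.M.a_assoc E.M.r_neg)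
        then have "l \<in> ?T" using x(1) E.submoduleD(6)[OF K(1) kl(1)] by (auto simp: set_add_def')
        then have "l = \<zero>\<^bsub>E\<^esub>" using L(2) kl(2) by blast
        then have "x = k" using kl(3) c by simp
        then show "x = \<zero>\<^bsub>E\<^esub>" using K(3) x(1) kl(1) by blast
      qed
      then have "K <+>\<^bsub>E\<^esub> L = K" by (rule max[OF _ E.sum_superset(1)[OF K(1) L(1)]])
      then have "L \<subseteq> K" using E.sum_superset(2)[OF K(1) L(1)] by blast
      then show "L \<subseteq> {\<zero>\<^bsub>E\<^esub>}" using L(2) E.sum_superset(2)[OF N(1) K(1)] by blast
    qed
    have uniq: "n = n'" if "n \<in> N" "n' \<in> N" "k \<in> K" "k' \<in> K" "n \<oplus>\<^bsub>E\<^esub> k = n' \<oplus>\<^bsub>E\<^esub> k'" for n n' k k'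
    proof -
      have c: "n \<in> carrier E" "n' \<in> carrier E" "k \<in> carrier E" "k' \<in> carrier E"
        using that E.submoduleD(3)[OF N(1)] E.submoduleD(3)[OF K(1)] by blast+
      have "n \<ominus>\<^bsub>E\<^esub> n' = (n \<oplus>\<^bsub>E\<^esub> k) \<oplus>\<^bsub>E\<^esub> (\<ominus>\<^bsub>E\<^esub> k \<oplus>\<^bsub>E\<^esub> \<ominus>\<^bsub>E\<^esub> n')"
        using c by (simp add: a_minus_def E.M.a_assoc E.M.r_neg1 E.M.r_neg2)
      also have "\<dots> = (k' \<oplus>\<^bsub>E\<^esub> n') \<oplus>\<^bsub>E\<^esub> (\<ominus>\<^bsub>E\<^esub> n' \<oplus>\<^bsub>E\<^esub> \<ominus>\<^bsub>E\<^esub> k)"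
        unfolding that(5) using c by (simp add: E.M.a_comm)
      also have "\<dots> = k' \<ominus>\<^bsub>E\<^esub> k"
        using c by (simp add: a_minus_def E.M.a_assoc E.M.r_neg1 E.M.r_neg2)
      finally have eq: "n \<ominus>\<^bsub>E\<^esub> n' = k' \<ominus>\<^bsub>E\<^esub> k" .
      have "n \<ominus>\<^bsub>E\<^esub> n' \<in> N" "k' \<ominus>\<^bsub>E\<^esub> k \<in> K"
        using E.submoduleD(5)[OF N(1)] E.submoduleD(5)[OF K(1)] that by blast+
      then have "n \<ominus>\<^bsub>E\<^esub> n' = \<zero>\<^bsub>E\<^esub>" using K(3) eq by simp
      then have 0: "n \<oplus>\<^bsub>E\<^esub> \<ominus>\<^bsub>E\<^esub> n' = \<zero>\<^bsub>E\<^esub>" by (simp add: a_minus_def)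
      show ?thesis using E.M.minus_equality[OF 0] c by simp
    qed
    \<comment> \<open>The projection N + K \<rightarrow> N along K; \<open>uniq\<close> is what
      makes the description definite.\<close>
    define \<pi> where "\<pi> y = (THE n. n \<in> N \<and> (\<exists>k\<in>K. y = n \<oplus>\<^bsub>E\<^esub> k))" for y
    have \<pi>: "\<pi> (n \<oplus>\<^bsub>E\<^esub> k) = n" if "n \<in> N" "k \<in> K" for n k
      unfolding \<pi>_def
    proof (rule the_equality)
      show "n \<in> N \<and> (\<exists>k'\<in>K. n \<oplus>\<^bsub>E\<^esub> k = n \<oplus>\<^bsub>E\<^esub> k')" using that by blast
      fix n' assume "n' \<in> N \<and> (\<exists>k'\<in>K. n \<oplus>\<^bsub>E\<^esub> k = n' \<oplus>\<^bsub>E\<^esub> k')"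
      then obtain k' where k': "n' \<in> N" "k' \<in> K" "n \<oplus>\<^bsub>E\<^esub> k = n' \<oplus>\<^bsub>E\<^esub> k'" by blast
      show "n' = n" by (rule sym, rule uniq[OF that(1) k'(1) that(2) k'(2,3)])
    qed
    note n = E.submoduleD[OF N(1)] and k = E.submoduleD[OF K(1)]
    have "lin R (E\<lparr>carrier := ?T\<rparr>) E \<pi>"
    proof (rule linI)
      fix x assume "x \<in> carrier (E\<lparr>carrier := ?T\<rparr>)"
      then obtain a b where "a \<in> N" "b \<in> K" "x = a \<oplus>\<^bsub>E\<^esub> b" by (auto simp: set_add_def')
      then show "\<pi> x \<in> carrier E" using \<pi> n(3) by simp
    next
      fix x y assume "x \<in> carrier (E\<lparr>carrier := ?T\<rparr>)" "y \<in> carrier (E\<lparr>carrier := ?T\<rparr>)"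
      then obtain a b c d where h: "a \<in> N" "b \<in> K" "x = a \<oplus>\<^bsub>E\<^esub> b" "c \<in> N" "d \<in> K" "y = c \<oplus>\<^bsub>E\<^esub> d"
        by (auto simp: set_add_def')
      have "x \<oplus>\<^bsub>E\<^esub> y = (a \<oplus>\<^bsub>E\<^esub> c) \<oplus>\<^bsub>E\<^esub> (b \<oplus>\<^bsub>E\<^esub> d)"
        using h n(3) k(3) by (simp add: E.M.a_ac)
      then show "\<pi> (x \<oplus>\<^bsub>E\<lparr>carrier := ?T\<rparr>\<^esub> y) = \<pi> x \<oplus>\<^bsub>E\<^esub> \<pi> y"
        using \<pi>[OF n(4)[OF h(1,4)] k(4)[OF h(2,5)]] \<pi>[OF h(1,2)] \<pi>[OF h(4,5)] h(3,6) by simp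
    next
      fix r x assume r: "r \<in> carrier R" "x \<in> carrier (E\<lparr>carrier := ?T\<rparr>)"
      then obtain a b where h: "a \<in> N" "b \<in> K" "x = a \<oplus>\<^bsub>E\<^esub> b" by (auto simp: set_add_def')
      then have "r \<odot>\<^bsub>E\<^esub> x = r \<odot>\<^bsub>E\<^esub> a \<oplus>\<^bsub>E\<^esub> r \<odot>\<^bsub>E\<^esub> b"
        using r(1) n(3) k(3) by (simp add: E.smult_r_distr)
      then show "\<pi> (r \<odot>\<^bsub>E\<lparr>carrier := ?T\<rparr>\<^esub> x) = r \<odot>\<^bsub>E\<^esub> \<pi> x"
        using \<pi>[OF n(7)[OF r(1) h(1)] k(7)[OF r(1) h(2)]] \<pi>[OF h(1,2)] h(3) by simp
    qed
    then obtain h where h: "lin R E E h" "\<And>x. x \<in> ?T \<Longrightarrow> h x = \<pi> x"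
      using injective_extend[OF E(1) ES T] by blast
    have hN: "h x = x" if "x \<in> N" for x
      using h(2)[of x] \<pi>[OF that k(2)] E.sum_superset(1)[OF N(1) K(1)] that n(3) by auto
    have hK: "h x = \<zero>\<^bsub>E\<^esub>" if "x \<in> K" for x
      using h(2)[of x] \<pi>[OF n(2) that] E.sum_superset(2)[OF N(1) K(1)] that k(3) by auto
    interpret h: linear_map R E E h by (rule linear_mapI[OF lE lE h(1)])
    \<comment> \<open>The defect of h from being idempotent. It vanishes on N + K, because there h
      is the projection, and so has essential kernel.\<close>
    let ?d = "\<lambda>x. h (h x) \<ominus>\<^bsub>E\<^esub> h x"
    have d: "lin R E E ?d" by (rule lin_minus[OF lE lE lin_comp[OF h(1) h(1)] h(1)])
    interpret d: linear_map R E E ?d by (rule linear_mapI[OF lE lE d])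
    have Td: "?T \<subseteq> Ker E E ?d"
    proof
      fix x assume "x \<in> ?T"
      then obtain a b where ab: "a \<in> N" "b \<in> K" "x = a \<oplus>\<^bsub>E\<^esub> b" by (auto simp: set_add_def')
      have c: "a \<in> carrier E" "b \<in> carrier E" using ab n(3) k(3) by blast+
      have "h x = a" using c by (simp add: ab(3) h.add hN[OF ab(1)] hK[OF ab(2)])
      then show "x \<in> Ker E E ?d" using hN[OF ab(1)] c ab(3) E.M.r_neg by (simp add: Ker_def a_minus_def)
    qed
    have dess: "essential_submodule R E (Ker E E ?d)"
      by (rule essential_superset[OF lE Tess d.submodule_kernel Td])
    \<comment> \<open>Nonsingularity does not apply to ?d directly, since ?d starts at
      \<open>E\<close>. It applies to ?d f for each f : M \<rightarrow> E, and the images of these f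
      generate \<open>E\<close>.\<close>
    have "Ker E E ?d = carrier E"
    proof (rule generator_trace[OF left_module generator ES d.submodule_kernel])
      fix f m assume f: "lin R M E f" and m: "m \<in> carrier M"
      interpret f: linear_map R M E f by (rule linear_map_from[OF lE f])
      have "{x \<in> carrier M. f x \<in> Ker E E ?d} = Ker M E (\<lambda>m. ?d (f m))" by (auto simp: Ker_def)
      then have "essential_submodule R M (Ker M E (\<lambda>m. ?d (f m)))"
        using f.essential_preimage[OF dess] by simp
      then have "?d (f m) = \<zero>\<^bsub>E\<^esub>" using E(3) lin_comp[OF f d] m unfolding nonsingular_over_def by blast
      then show "f m \<in> Ker E E ?d" using m by (simp add: Ker_def)
    qed
    then have hh: "h (h x) = h x" if x: "x \<in> carrier E" for x
    proof -
      have "h (h x) \<oplus>\<^bsub>E\<^esub> \<ominus>\<^bsub>E\<^esub> h x = \<zero>\<^bsub>E\<^esub>" using that \<open>Ker E E ?d = carrier E\<close> by (auto simp: Ker_def a_minus_def)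
      from E.M.minus_equality[OF this] show ?thesis using x by simp
    qed
    have im: "submodule (h ` carrier E) R E" by (rule h.submodule_image[OF E.submodule_carrier])
    have "Ker E E h \<inter> h ` carrier E = {\<zero>\<^bsub>E\<^esub>}"
    proof
      show "Ker E E h \<inter> h ` carrier E \<subseteq> {\<zero>\<^bsub>E\<^esub>}" using hh by (auto simp: Ker_def)
      show "{\<zero>\<^bsub>E\<^esub>} \<subseteq> Ker E E h \<inter> h ` carrier E"
        using E.submoduleD(2)[OF im] E.submoduleD(2)[OF h.submodule_kernel] by blast
    qed
    moreover have "Ker E E h <+>\<^bsub>E\<^esub> h ` carrier E = carrier E"
    proof
      show "Ker E E h <+>\<^bsub>E\<^esub> h ` carrier E \<subseteq> carrier E"
        by (rule E.submoduleD(1)[OF E.submodule_sum[OF h.submodule_kernel im]])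
      show "carrier E \<subseteq> Ker E E h <+>\<^bsub>E\<^esub> h ` carrier E"
      proof
        fix x assume x: "x \<in> carrier E"
        have "h (x \<ominus>\<^bsub>E\<^esub> h x) = \<zero>\<^bsub>E\<^esub>"
          using h.minus[of x "h x"] x hh[OF x] E.M.r_neg by (simp add: a_minus_def)
        then have "x \<ominus>\<^bsub>E\<^esub> h x \<in> Ker E E h" using x by (simp add: Ker_def)
        moreover have "x = (x \<ominus>\<^bsub>E\<^esub> h x) \<oplus>\<^bsub>E\<^esub> h x"
          using x by (simp add: a_minus_def E.M.a_assoc E.M.l_neg)
        ultimately show "x \<in> Ker E E h <+>\<^bsub>E\<^esub> h ` carrier E"
          using x unfolding set_add_def' by blast
      qed
    qed
    ultimately have "Ker E E h = {\<zero>\<^bsub>E\<^esub>} \<or> h ` carrier E = {\<zero>\<^bsub>E\<^esub>}"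
      using E(2) h.submodule_kernel im unfolding indecomposable_def by blast
    moreover have "h ` carrier E \<noteq> {\<zero>\<^bsub>E\<^esub>}"
    proof
      assume h0: "h ` carrier E = {\<zero>\<^bsub>E\<^esub>}"
      have "x = \<zero>\<^bsub>E\<^esub>" if "x \<in> N" for x
      proof -
        have "h x \<in> {\<zero>\<^bsub>E\<^esub>}" unfolding h0[symmetric] using n(3)[OF that] by (rule imageI)
        then show ?thesis using hN[OF that] by simp
      qed
      then have "N = {\<zero>\<^bsub>E\<^esub>}" using n(2) by blast
      then show False using N(2) by simp
    qed
    ultimately have "Ker E E h = {\<zero>\<^bsub>E\<^esub>}" by blast
    moreover have "K0 \<subseteq> Ker E E h" using hK K(2) k(3) by (auto simp: Ker_def)
    ultimately show "K0 \<subseteq> {\<zero>\<^bsub>E\<^esub>}" by simp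
  qed
qed

text \<open>A single preimage of N is essential, but infinitely many are intersected here. A finite
  G with the same common kernel as all maps M \<rightarrow> E is enough: injectivity of
  \<open>E\<close> and full invariance of N carry membership in N from the maps in G to every other
  map.\<close>

lemma common_preimage_essential:
  assumes E: "injective_in_sigma R M E" "nonsingular_over R M E" and fud: "finite_uniform_dimension R M"
    and N: "fully_invariant R E N" "essential_submodule R E N"
  shows "essential_submodule R M {m \<in> carrier M. \<forall>f. lin R M E f \<longrightarrow> f m \<in> N}"
proof -
  have ES: "E \<in> sigma_cat R M" using E(1) by (simp add: injective_in_sigma_def)
  then have lE: "left_module R E" by (simp add: sigma_cat_def)
  interpret E: left_module R E by (rule lE)
  have sN: "submodule N R E" using N(1) by (simp add: fully_invariant_def)
  note n = E.submoduleD[OF sN]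
  have preimages: "essential_submodule R M {x \<in> carrier M. \<forall>g\<in>G. g x \<in> N}"
    if "finite G" "\<And>g. g \<in> G \<Longrightarrow> lin R M E g" for G
    using that
  proof (induction G rule: finite_induct)
    case empty
    then show ?case using essential_carrier[OF left_module] by simp
  next
    case (insert g G)
    interpret g: linear_map R M E g by (rule linear_map_from[OF lE]) (simp add: insert.prems)
    have "{x \<in> carrier M. \<forall>h\<in>insert g G. h x \<in> N} =
        {x \<in> carrier M. g x \<in> N} \<inter> {x \<in> carrier M. \<forall>g\<in>G. g x \<in> N}" by auto
    then show ?case
      using essential_Int[OF left_module g.essential_preimage[OF N(2)] insert.IH] insert.prems by simp
  qed
  \<comment> \<open>Modulo maps that vanish, f is a combination of the g in G with coefficients in
    End(E). Each induction step removes one g by subtracting a suitable d g from f.\<close>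
  have reduce: "f m \<in> N"
    if "finite G" "\<And>g. g \<in> G \<Longrightarrow> lin R M E g" "lin R M E f"
      "\<And>x. x \<in> carrier M \<Longrightarrow> (\<And>g. g \<in> G \<Longrightarrow> g x = \<zero>\<^bsub>E\<^esub>) \<Longrightarrow> f x = \<zero>\<^bsub>E\<^esub>"
      "m \<in> carrier M" "\<And>g. g \<in> G \<Longrightarrow> g m \<in> N" for G f m
    using that
  proof (induction G arbitrary: f rule: finite_induct)
    case empty
    have "f m = \<zero>\<^bsub>E\<^esub>" by (rule empty.prems(3)) (simp_all add: empty.prems)
    then show ?case using n(2) by simp
  next
    case (insert g G)
    have g: "lin R M E g" and G: "\<And>g. g \<in> G \<Longrightarrow> lin R M E g" using insert.prems(1) by blast+
    note f = insert.prems(2) and vanish = insert.prems(3) and m = insert.prems(4,5)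
    interpret g: linear_map R M E g by (rule linear_map_from[OF lE g])
    \<comment> \<open>On the common kernel of the remaining maps, f vanishes wherever g does. So f =
      d g there with d defined on g(B), and injectivity extends d to \<open>E\<close>; then f - d g
      vanishes on B and the induction hypothesis applies to it.\<close>
    let ?B = "{x \<in> carrier M. \<forall>g\<in>G. g x = \<zero>\<^bsub>E\<^esub>}"
    have B: "submodule ?B R M" by (rule submodule_common_kernel[OF left_module lE G])
    have lB: "left_module R (M\<lparr>carrier := ?B\<rparr>)" by (rule left_module_submodule[OF B])
    have Bs: "?B \<subseteq> carrier M" by blast
    have v: "f a = \<zero>\<^bsub>E\<^esub>" if "a \<in> carrier (M\<lparr>carrier := ?B\<rparr>)" "g a = \<zero>\<^bsub>E\<^esub>" for a
      by (rule vanish) (use that in auto)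
    obtain d0 where d0: "lin R (E\<lparr>carrier := g ` carrier (M\<lparr>carrier := ?B\<rparr>)\<rparr>) E d0"
      "\<And>a. a \<in> carrier (M\<lparr>carrier := ?B\<rparr>) \<Longrightarrow> d0 (g a) = f a"
      using factor_through_image[OF lB lE lE lin_subdomain[OF g Bs] lin_subdomain[OF f Bs] v] by blast
    have gB: "submodule (g ` ?B) R E" by (rule g.submodule_image[OF B])
    have "lin R (E\<lparr>carrier := g ` ?B\<rparr>) E d0" using d0(1) by simp
    then obtain d where d: "lin R E E d" "\<And>x. x \<in> g ` ?B \<Longrightarrow> d x = d0 x"
      using injective_extend[OF E(1) ES gB] by blast
    let ?f = "\<lambda>x. f x \<ominus>\<^bsub>E\<^esub> d (g x)"
    have dg: "lin R M E (\<lambda>x. d (g x))" by (rule lin_comp[OF g d(1)])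
    have "?f m \<in> N"
    proof (rule insert.IH[OF G])
      show "lin R M E ?f" by (rule lin_minus[OF left_module lE f dg])
      fix x assume x: "x \<in> carrier M" "\<And>g. g \<in> G \<Longrightarrow> g x = \<zero>\<^bsub>E\<^esub>"
      then have xB: "x \<in> ?B" by blast
      then have "d (g x) = d0 (g x)" by (intro d(2) imageI)
      also have "\<dots> = f x" using d0(2)[of x] xB by simp
      finally show "?f x = \<zero>\<^bsub>E\<^esub>" using lin_closed[OF f x(1)] by (simp add: a_minus_def E.M.r_neg)
    qed (use m in auto)
    moreover have "d (g m) \<in> N"
      by (rule fully_invariantD[OF lE N(1) d(1)]) (use m in simp)
    moreover have "f m = ?f m \<oplus>\<^bsub>E\<^esub> d (g m)"
      using lin_closed[OF f m(1)] lin_closed[OF dg m(1)] by (simp add: a_minus_def E.M.a_assoc E.M.l_neg)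
    ultimately show ?case using n(4)[of "?f m" "d (g m)"] by simp
  qed
  obtain G where G: "finite G" "G \<subseteq> {f. lin R M E f}"
    "\<And>m f. m \<in> carrier M \<Longrightarrow> (\<And>g. g \<in> G \<Longrightarrow> g m = \<zero>\<^bsub>E\<^esub>) \<Longrightarrow> f \<in> {f. lin R M E f} \<Longrightarrow> f m = \<zero>\<^bsub>E\<^esub>"
    using finite_common_kernel[OF lE E(2) fud, of "{f. lin R M E f}"] by blast
  have Gl: "lin R M E g" if "g \<in> G" for g using G(2) that by blast
  have "f m \<in> N" if "m \<in> carrier M" "\<And>g. g \<in> G \<Longrightarrow> g m \<in> N" "lin R M E f" for f m
  proof (rule reduce[where G = G and f = f and m = m])
    show "f x = \<zero>\<^bsub>E\<^esub>" if "x \<in> carrier M" "\<And>g. g \<in> G \<Longrightarrow> g x = \<zero>\<^bsub>E\<^esub>" for x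
      by (rule G(3)[of x f]) (use that \<open>lin R M E f\<close> in auto)
  qed (use G(1) Gl that in auto)
  then have "{m \<in> carrier M. \<forall>f. lin R M E f \<longrightarrow> f m \<in> N} = {x \<in> carrier M. \<forall>g\<in>G. g x \<in> N}"
    using Gl by blast
  then show ?thesis using preimages[OF G(1) Gl] by simp
qed

end

subsection \<open>Co-semisimple progenerators\<close>

locale cosemisimple_progenerator = progenerator_module R M
  for R :: "('r, 'k) ring_scheme" and M :: "('r, 'u) module" +
  assumes co_semisimple: "co_semisimple R M"
begin

text \<open>Failure leaves K + Ker x proper. A map g on \<open>M\<close> with g x = p into the
  simple quotient by a maximal P above it would kill x(M), because x(M) lies in K and g kills K; so
  p = 0, against P being proper.\<close>

lemma image_of_invariant:
  assumes x: "lin R M M x" and K: "fully_invariant R M K"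
    and xK: "\<And>m. m \<in> carrier M \<Longrightarrow> x m \<in> K" and m: "m \<in> carrier M"
  obtains k where "k \<in> K" "x k = x m"
proof (rule ccontr)
  note main = that
  assume "\<not> thesis"
  then have no: "x k \<noteq> x m" if "k \<in> K" for k using main[of k] that by blast
  interpret x: linear_map R M M x by (rule linear_map_from[OF left_module x])
  have sK: "submodule K R M" using K by (simp add: fully_invariant_def)
  \<comment> \<open>Membership of m in K + Ker x is equivalent to x m lying in x(K).\<close>
  let ?L = "K <+>\<^bsub>M\<^esub> Ker M M x"
  have L: "submodule ?L R M" by (rule submodule_sum[OF sK x.submodule_kernel])
  have "m \<notin> ?L"
  proof
    assume "m \<in> ?L"
    then obtain k e where ke: "k \<in> K" "e \<in> carrier M" "x e = \<zero>\<^bsub>M\<^esub>" "m = k \<oplus>\<^bsub>M\<^esub> e"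
      by (auto simp: set_add_def' Ker_def)
    then have "x m = x k" using x.add[of k e] submoduleD(3)[OF sK ke(1)] by simp
    then show False using no[OF ke(1)] by simp
  qed
  then have "?L \<noteq> carrier M" using m by blast
  then obtain P where P: "submodule P R M" "?L \<subseteq> P" "P \<noteq> carrier M"
    "\<And>L. submodule L R M \<Longrightarrow> P \<subseteq> L \<Longrightarrow> L = P \<or> L = carrier M"
    using maximal_submodule_exists[OF left_module finitely_generated L] by blast
  obtain Q :: "('r, 'u) module" and p where Q: "left_module R Q" "lin R M Q p"
    "p ` carrier M = carrier Q" "\<And>m. m \<in> carrier M \<Longrightarrow> p m = \<zero>\<^bsub>Q\<^esub> \<longleftrightarrow> m \<in> P"
    using quotient_module_exists[OF left_module P(1)] by blast
  interpret p: linear_map R M Q p by (rule linear_map_from[OF Q(1,2)])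
  have QS: "Q \<in> sigma_cat R M" by (rule quotient_in_sigma[OF left_module Q(1-3)])
  have "simple_mod R Q"
    unfolding simple_mod_def
  proof (intro conjI allI impI)
    obtain y where y: "y \<in> carrier M" "y \<notin> P" using P(3) submoduleD(1)[OF P(1)] by blast
    then have "p y \<noteq> \<zero>\<^bsub>Q\<^esub>" using Q(4) by blast
    then show "carrier Q \<noteq> {\<zero>\<^bsub>Q\<^esub>}" using p.closed[OF y(1)] by (metis singletonD)
    fix N assume N: "submodule N R Q"
    let ?N = "{m \<in> carrier M. p m \<in> N}"
    have "P \<subseteq> ?N"
    proof
      fix y assume y: "y \<in> P"
      then have "y \<in> carrier M" by (rule submoduleD(3)[OF P(1)])
      then show "y \<in> ?N" using Q(4)[of y] y p.B.submoduleD(2)[OF N] by simp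
    qed
    then consider "?N = P" | "?N = carrier M" using P(4) p.submodule_preimage[OF N] by blast
    then show "N = {\<zero>\<^bsub>Q\<^esub>} \<or> N = carrier Q"
    proof cases
      case 1
      have "y = \<zero>\<^bsub>Q\<^esub>" if y: "y \<in> N" for y
      proof -
        obtain m where m: "m \<in> carrier M" "y = p m" using p.B.submoduleD(3)[OF N y] Q(3) by blast
        then have "m \<in> ?N" using y by simp
        then show ?thesis using 1 m Q(4) by blast
      qed
      then show ?thesis using p.B.submoduleD(2)[OF N] by blast
    next
      case 2
      then have "p ` carrier M \<subseteq> N" by blast
      then show ?thesis using Q(3) p.B.submoduleD(1)[OF N] by blast
    qed
  qed
  then have inj: "M_injective R M Q" using co_semisimple QS by (simp add: co_semisimple_def)
  have T: "submodule (x ` carrier M) R M" by (rule x.submodule_image[OF submodule_carrier])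
  have "p a = \<zero>\<^bsub>Q\<^esub>" if "a \<in> carrier M" "x a = \<zero>\<^bsub>M\<^esub>" for a
  proof -
    have "a \<in> Ker M M x" using that by (simp add: Ker_def)
    then have "a \<in> P" using P(2) sum_superset(2)[OF sK x.submodule_kernel] by blast
    then show ?thesis using Q(4) that(1) by blast
  qed
  then obtain f where f: "lin R (M\<lparr>carrier := x ` carrier M\<rparr>) Q f"
    "\<And>a. a \<in> carrier M \<Longrightarrow> f (x a) = p a"
    using factor_through_image[OF left_module left_module Q(1) x Q(2)] by blast
  have "restrict f (x ` carrier M) \<in> Hom R (M\<lparr>carrier := x ` carrier M\<rparr>) Q"
    using restrict_in_Hom[OF f(1) left_module_submodule[OF T]] by simp
  then obtain g where g: "g \<in> Hom R M Q" "\<forall>y\<in>x ` carrier M. g y = restrict f (x ` carrier M) y"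
    using inj T unfolding M_injective_def by blast
  have gx: "g (x a) = p a" if "a \<in> carrier M" for a
    using g(2) f(2)[OF that] that by simp
  have gl: "lin R M Q g" using g(1) by (simp add: Hom_iff_lin)
  \<comment> \<open>Full invariance of K says nothing about g, whose codomain is the quotient. The
    lift s is an endomorphism of \<open>M\<close>, so s(K) \<subseteq> K \<subseteq> P and g = p s
    vanishes on K.\<close>
  obtain s where s: "lin R M M s" "\<And>m. m \<in> carrier M \<Longrightarrow> p (s m) = g m"
    using projective_lift[OF left_module projective self_in_sigma[OF left_module] QS Q(2,3) gl] by blast
  have gK: "g k = \<zero>\<^bsub>Q\<^esub>" if "k \<in> K" for k
  proof -
    have k: "k \<in> carrier M" using submoduleD(3)[OF sK that] .
    have "s k \<in> K" by (rule fully_invariantD[OF left_module K s(1) that])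
    then have "s k \<in> P" using P(2) sum_superset(1)[OF sK x.submodule_kernel] by blast
    then show ?thesis using s(2)[OF k] Q(4)[of "s k"] lin_closed[OF s(1) k] by simp
  qed
  have "a \<in> P" if "a \<in> carrier M" for a
    using gK[OF xK[OF that]] gx[OF that] Q(4)[OF that] by simp
  then show False using P(3) submoduleD(1)[OF P(1)] by blast
qed

text \<open>The set of m with z t m = 0 for all t is fully invariant and, by \<open>ztz\<close>,
  contains z(M). Hence \<open>image_of_invariant\<close> represents z m as z k with k in this set,
  and t = 1 gives z k = 0.\<close>

lemma semiprime:
  assumes z: "lin R M M z"
    and ztz: "\<And>t m. lin R M M t \<Longrightarrow> m \<in> carrier M \<Longrightarrow> z (t (z m)) = \<zero>\<^bsub>M\<^esub>"
    and m: "m \<in> carrier M"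
  shows "z m = \<zero>\<^bsub>M\<^esub>"
proof -
  interpret z: linear_map R M M z by (rule linear_map_from[OF left_module z])
  let ?N = "{m \<in> carrier M. \<forall>t. lin R M M t \<longrightarrow> z (t m) = \<zero>\<^bsub>M\<^esub>}"
  have zt: "linear_map R M M (\<lambda>m. z (t m))" if "lin R M M t" for t
    by (rule linear_map_from[OF left_module lin_comp[OF that z]])
  have N: "submodule ?N R M"
  proof (rule submoduleI)
    show "\<zero>\<^bsub>M\<^esub> \<in> ?N" using linear_map.zero[OF zt] by simp
    show "x \<oplus>\<^bsub>M\<^esub> y \<in> ?N" if "x \<in> ?N" "y \<in> ?N" for x y
      using that linear_map.add[OF zt, of _ x y] by simp
    show "r \<odot>\<^bsub>M\<^esub> x \<in> ?N" if "r \<in> carrier R" "x \<in> ?N" for r x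
      using that linear_map.smult[OF zt, of _ r x] by simp
  qed blast
  have "fully_invariant R M ?N"
  proof (rule fully_invariantI[OF N])
    fix f x assume f: "lin R M M f" and x: "x \<in> ?N"
    have "z (t x) = \<zero>\<^bsub>M\<^esub>" if "lin R M M t" for t using x that by blast
    from this[OF lin_comp[OF f]] show "f x \<in> ?N" using x lin_closed[OF f] by simp
  qed
  moreover have "z a \<in> ?N" if "a \<in> carrier M" for a using ztz[OF _ that] z.closed[OF that] by simp
  ultimately obtain k where k: "k \<in> ?N" "z k = z m" by (rule image_of_invariant[OF z _ _ m])
  have "z (t k) = \<zero>\<^bsub>M\<^esub>" if "lin R M M t" for t using k(1) that by blast
  from this[OF lin_id] show ?thesis using k(2) by simp
qed

text \<open>For a singular z \<noteq> 0, \<open>semiprime\<close> supplies t with z t z \<noteq> 0.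
  This map is again singular and its kernel is strictly larger, so iteration violates the chain
  condition.\<close>

lemma nonsingular:
  assumes acc: "ACC_left_annihilators R M"
  shows "nonsingular_over R M M"
proof (rule ccontr)
  define Z where "Z = {z. lin R M M z \<and> essential_submodule R M (Ker M M z) \<and> (\<exists>m\<in>carrier M. z m \<noteq> \<zero>\<^bsub>M\<^esub>)}"
  assume "\<not> nonsingular_over R M M"
  then have "\<exists>z. z \<in> Z" unfolding nonsingular_over_def Z_def by blast
  moreover have "\<exists>z'\<in>Z. Ker M M z \<subset> Ker M M z'" if z: "z \<in> Z" for z
  proof -
    have lz: "lin R M M z" and ess: "essential_submodule R M (Ker M M z)"
      and nz: "\<exists>m\<in>carrier M. z m \<noteq> \<zero>\<^bsub>M\<^esub>" using z by (simp_all add: Z_def)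
    interpret z: linear_map R M M z by (rule linear_map_from[OF left_module lz])
    obtain t where t: "lin R M M t" "\<exists>m\<in>carrier M. z (t (z m)) \<noteq> \<zero>\<^bsub>M\<^esub>"
      using semiprime[OF lz] nz by blast
    interpret t: linear_map R M M t by (rule linear_map_from[OF left_module t(1)])
    let ?z = "\<lambda>m. z (t (z m))"
    have lzz: "lin R M M ?z" by (rule lin_comp[OF lin_comp[OF lz t(1)] lz])
    have sub: "Ker M M z \<subseteq> Ker M M ?z" by (auto simp: Ker_def)
    have "essential_submodule R M (Ker M M ?z)"
      by (rule essential_superset[OF left_module ess _ sub])
        (rule linear_map.submodule_kernel[OF linear_map_from[OF left_module lzz]])
    then have Z': "?z \<in> Z" using lzz t(2) by (simp add: Z_def)
    \<comment> \<open>The preimage of Ker z under t is essential. If z t z had the same kernel as z,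
      that preimage would meet z(M) only in zero, forcing z = 0.\<close>
    have "Ker M M z \<noteq> Ker M M ?z"
    proof
      assume eq: "Ker M M z = Ker M M ?z"
      have "z ` carrier M = {\<zero>\<^bsub>M\<^esub>}"
      proof (rule essentialD[OF left_module t.essential_preimage[OF ess] z.submodule_image[OF submodule_carrier]])
        fix y assume y: "y \<in> {x \<in> carrier M. t x \<in> Ker M M z}" "y \<in> z ` carrier M"
        then obtain m where m: "m \<in> carrier M" "y = z m" by blast
        have "m \<in> Ker M M ?z" using y(1) m by (simp add: Ker_def)
        then have "m \<in> Ker M M z" by (simp only: eq)
        then show "y = \<zero>\<^bsub>M\<^esub>" using m(2) by (simp add: Ker_def)
      qed
      then show False using nz by blast
    qed
    then show ?thesis using Z' sub by blast
  qed
  ultimately obtain c where c: "\<And>n::nat. c n \<in> Z" "\<And>n. Ker M M (c n) \<subset> Ker M M (c (Suc n))"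
    using dependent_nat_choice[of "\<lambda>_ z. z \<in> Z" "\<lambda>_ z z'. Ker M M z \<subset> Ker M M z'"] by (metis (no_types))
  \<comment> \<open>A kernel is the left annihilator given by a one-element set; restriction to the
    carrier is required for membership in \<open>Hom\<close>.\<close>
  have "left_annihilator R M (Ker M M (c n))" for n
  proof -
    have "restrict (c n) (carrier M) \<in> Hom R M M"
      by (rule restrict_in_Hom[OF _ left_module]) (use c(1)[of n] in \<open>simp add: Z_def\<close>)
    moreover have "Ker M M (c n) = carrier M \<inter> (\<Inter>f\<in>{restrict (c n) (carrier M)}. Ker M M f)"
      by (auto simp: Ker_def)
    ultimately show ?thesis unfolding left_annihilator_def by blast
  qed
  moreover have "Ker M M (c n) \<subseteq> Ker M M (c (Suc n))" for n using c(2)[of n] by (rule psubset_imp_subset)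
  ultimately obtain n0 where n0: "\<forall>n\<ge>n0. Ker M M (c n) = Ker M M (c n0)"
    using acc[unfolded ACC_left_annihilators_def, THEN spec, of "\<lambda>n. Ker M M (c n)"] by blast
  have "Ker M M (c (Suc n0)) = Ker M M (c n0)" by (rule n0[rule_format]) simp
  then show False using c(2)[of n0] by blast
qed

text \<open>The endomorphisms with values in K form an ideal J of End(M), and the aim is to find the
  identity in J. Local units exist by \<open>image_of_invariant\<close> and projectivity, and
  finitely many elements of J already have the common kernel of all of J.\<close>

lemma essential_fully_invariant_eq_carrier:
  assumes ns: "nonsingular_over R M M" and fud: "finite_uniform_dimension R M"
    and K: "fully_invariant R M K" "essential_submodule R M K"
  shows "K = carrier M"
proof -
  have sK: "submodule K R M" using K(1) by (simp add: fully_invariant_def)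
  note k = submoduleD[OF sK]
  define J where "J = {x. lin R M M x \<and> (\<forall>m\<in>carrier M. x m \<in> K)}"
  have J: "lin R M M x" "\<And>m. m \<in> carrier M \<Longrightarrow> x m \<in> K" if "x \<in> J" for x
    using that by (simp_all add: J_def)
  \<comment> \<open>\<open>image_of_invariant\<close> makes w : K \<rightarrow> w(M) surjective, so
    w : M \<rightarrow> w(M) lifts along it to a map b from \<open>M\<close> into K.\<close>
  have weak_unit: "\<exists>b\<in>J. \<forall>m\<in>carrier M. w (b m) = w m" if w: "w \<in> J" for w
  proof -
    interpret w: linear_map R M M w by (rule linear_map_from[OF left_module J(1)[OF w]])
    let ?T = "w ` carrier M"
    have T: "submodule ?T R M" by (rule w.submodule_image[OF submodule_carrier])
    have surj: "w ` K = ?T"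
    proof
      show "w ` K \<subseteq> ?T" using k(1) by blast
      show "?T \<subseteq> w ` K"
      proof
        fix y assume "y \<in> ?T"
        then obtain m where m: "m \<in> carrier M" "y = w m" by blast
        obtain a where "a \<in> K" "w a = w m"
          by (rule image_of_invariant[OF J(1)[OF w] K(1) J(2)[OF w] m(1)])
        then show "y \<in> w ` K" using m(2) by (metis imageI)
      qed
    qed
    have wT: "lin R M (M\<lparr>carrier := ?T\<rparr>) w" by (rule lin_subcodomain[OF w.lin]) blast
    have wKT: "lin R (M\<lparr>carrier := K\<rparr>) (M\<lparr>carrier := ?T\<rparr>) w" by (rule lin_subdomain[OF wT k(1)])
    obtain b where b: "lin R M (M\<lparr>carrier := K\<rparr>) b" "\<And>m. m \<in> carrier M \<Longrightarrow> w (b m) = w m"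
      using projective_lift[OF left_module projective submodule_in_sigma[OF self_in_sigma[OF left_module] sK]
          submodule_in_sigma[OF self_in_sigma[OF left_module] T] wKT _ wT] surj by auto
    have "b \<in> J" using lin_from_subcodomain[OF b(1) k(1)] lin_closed[OF b(1)] by (simp add: J_def)
    then show ?thesis using b(2) by blast
  qed
  have unit: "\<exists>a\<in>J. \<forall>x\<in>G. \<forall>m\<in>carrier M. x (a m) = x m" if "finite G" "G \<subseteq> J" for G
    using that
  proof (induction G rule: finite_induct)
    case empty
    have "lin R M M (\<lambda>_. \<zero>\<^bsub>M\<^esub>)" by (rule linI) simp_all
    then have "(\<lambda>_. \<zero>\<^bsub>M\<^esub>) \<in> J" using k(2) by (simp add: J_def)
    then show ?case by blast
  next
    case (insert y G)
    then obtain a where a: "a \<in> J" "\<And>x m. x \<in> G \<Longrightarrow> m \<in> carrier M \<Longrightarrow> x (a m) = x m" by blast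
    have y: "y \<in> J" and G: "G \<subseteq> J" using insert.prems by blast+
    interpret a: linear_map R M M a by (rule linear_map_from[OF left_module J(1)[OF a(1)]])
    \<comment> \<open>The part of y that a does not yet fix on the right; a weak unit b for it
      repairs this.\<close>
    let ?w = "\<lambda>m. y m \<ominus>\<^bsub>M\<^esub> y (a m)"
    have "lin R M M ?w" by (rule lin_minus[OF left_module left_module J(1)[OF y] lin_comp[OF a.lin J(1)[OF y]]])
    then have "?w \<in> J" using k(5)[OF J(2)[OF y] J(2)[OF y]] by (simp add: J_def)
    then obtain b where b: "b \<in> J" "\<And>m. m \<in> carrier M \<Longrightarrow> ?w (b m) = ?w m"
      using weak_unit by blast
    interpret b: linear_map R M M b by (rule linear_map_from[OF left_module J(1)[OF b(1)]])
    \<comment> \<open>In End(M) this is 1 - c = (1 - a)(1 - b). For x in G already x (1 - a) = 0,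
      and y (1 - a) is the map ?w, which 1 - b annihilates.\<close>
    let ?c = "\<lambda>m. a m \<oplus>\<^bsub>M\<^esub> (b m \<ominus>\<^bsub>M\<^esub> a (b m))"
    have bab: "lin R M M (\<lambda>m. b m \<ominus>\<^bsub>M\<^esub> a (b m))"
      by (rule lin_minus[OF left_module left_module b.lin lin_comp[OF b.lin a.lin]])
    have "lin R M M ?c" by (rule lin_plus[OF left_module left_module a.lin bab])
    then have c: "?c \<in> J"
      using k(4)[OF J(2)[OF a(1)] k(5)[OF J(2)[OF b(1)] J(2)[OF a(1)]]] by (simp add: J_def)
    have xc: "x (?c m) = x (a m) \<oplus>\<^bsub>M\<^esub> (x (b m) \<ominus>\<^bsub>M\<^esub> x (a (b m)))"
      if "x \<in> J" "m \<in> carrier M" for x m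
    proof -
      interpret x: linear_map R M M x by (rule linear_map_from[OF left_module J(1)[OF that(1)]])
      show ?thesis using that(2) by (simp add: x.add x.minus)
    qed
    have "x (?c m) = x m" if "x \<in> insert y G" "m \<in> carrier M" for x m
    proof -
      have xJ: "x \<in> J" using that(1) y G by blast
      have cl: "x n \<in> carrier M" if "n \<in> carrier M" for n using lin_closed[OF J(1)[OF xJ] that] .
      show ?thesis
      proof (cases "x = y")
        case True
        have "x (?c m) = x (a m) \<oplus>\<^bsub>M\<^esub> (x m \<ominus>\<^bsub>M\<^esub> x (a m))"
          using xc[OF xJ that(2)] b(2)[OF that(2)] True by simp
        also have "\<dots> = x m"
          using cl[OF that(2)] cl[OF a.closed[OF that(2)]]
          by (simp add: a_minus_def M.a_comm[of "x m"] M.r_neg2)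
        finally show ?thesis .
      next
        case False
        then have xG: "x \<in> G" using that(1) by blast
        have "x (?c m) = x m \<oplus>\<^bsub>M\<^esub> (x (b m) \<ominus>\<^bsub>M\<^esub> x (b m))"
          using xc[OF xJ that(2)] a(2)[OF xG] that(2) by simp
        also have "\<dots> = x m" using cl[OF that(2)] cl[OF b.closed[OF that(2)]]
          by (simp add: a_minus_def M.r_neg)
        finally show ?thesis .
      qed
    qed
    then show ?case by (intro bexI[OF _ c] ballI)
  qed
  \<comment> \<open>An a in J with x a = x for all x in this G sends every m - a m into the common
    kernel of G, which is that of J.\<close>
  obtain G where G: "finite G" "G \<subseteq> J"
    "\<And>m f. m \<in> carrier M \<Longrightarrow> (\<And>g. g \<in> G \<Longrightarrow> g m = \<zero>\<^bsub>M\<^esub>) \<Longrightarrow> f \<in> J \<Longrightarrow> f m = \<zero>\<^bsub>M\<^esub>"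
    using finite_common_kernel[OF left_module ns fud, of J] J(1) by blast
  obtain a where a: "a \<in> J" "\<And>x m. x \<in> G \<Longrightarrow> m \<in> carrier M \<Longrightarrow> x (a m) = x m"
    using unit[OF G(1,2)] by blast
  interpret a: linear_map R M M a by (rule linear_map_from[OF left_module J(1)[OF a(1)]])
  let ?A = "{m \<in> carrier M. \<forall>x\<in>J. x m = \<zero>\<^bsub>M\<^esub>}"
  have jl: "linear_map R M M x" if "x \<in> J" for x by (rule linear_map_from[OF left_module J(1)[OF that]])
  have A: "submodule ?A R M"
    by (rule submodule_common_kernel[OF left_module left_module J(1)])
  have "{\<zero>\<^bsub>M\<^esub>} = ?A \<inter> K"
  proof (rule trace_submodule[OF self_in_sigma[OF left_module] submodule_Int[OF A sK] submodule_zero])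
    show "{\<zero>\<^bsub>M\<^esub>} \<subseteq> ?A \<inter> K" using submoduleD(2)[OF submodule_Int[OF A sK]] by blast
    \<comment> \<open>For an endomorphism t the composite s t has values in K and so belongs to J,
      while s takes values in the common kernel of J. Hence s t s = 0 for every t, and
      \<open>semiprime\<close> applies.\<close>
    fix s m assume s: "lin R M M s" "\<And>m. m \<in> carrier M \<Longrightarrow> s m \<in> ?A \<inter> K" and m: "m \<in> carrier M"
    have "s m = \<zero>\<^bsub>M\<^esub>"
    proof (rule semiprime[OF s(1) _ m])
      fix t n assume t: "lin R M M t" and n: "n \<in> carrier M"
      have st: "(\<lambda>m. s (t m)) \<in> J" using lin_comp[OF t s(1)] s(2) lin_closed[OF t] by (simp add: J_def)
      have "x (s n) = \<zero>\<^bsub>M\<^esub>" if "x \<in> J" for x using s(2)[OF n] that by blast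
      from this[OF st] show "s (t (s n)) = \<zero>\<^bsub>M\<^esub>" .
    qed
    then show "s m \<in> {\<zero>\<^bsub>M\<^esub>}" by simp
  qed
  then have "?A = {\<zero>\<^bsub>M\<^esub>}" using essentialD[OF left_module K(2) A] by blast
  moreover have "m \<ominus>\<^bsub>M\<^esub> a m \<in> ?A" if m: "m \<in> carrier M" for m
  proof -
    have ma: "m \<ominus>\<^bsub>M\<^esub> a m \<in> carrier M" using m by simp
    have "g (m \<ominus>\<^bsub>M\<^esub> a m) = \<zero>\<^bsub>M\<^esub>" if g: "g \<in> G" for g
    proof -
      interpret g: linear_map R M M g by (rule jl) (use g G(2) in blast)
      have "g (m \<ominus>\<^bsub>M\<^esub> a m) = g m \<ominus>\<^bsub>M\<^esub> g m" using g.minus[OF m a.closed[OF m]] a(2)[OF g m] by simp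
      then show ?thesis using m by (simp add: a_minus_def M.r_neg)
    qed
    then show ?thesis using G(3)[OF ma] ma by blast
  qed
  ultimately have am: "m \<ominus>\<^bsub>M\<^esub> a m = \<zero>\<^bsub>M\<^esub>" if "m \<in> carrier M" for m using that by blast
  have "m \<in> K" if m: "m \<in> carrier M" for m
  proof -
    have 0: "m \<oplus>\<^bsub>M\<^esub> \<ominus>\<^bsub>M\<^esub> a m = \<zero>\<^bsub>M\<^esub>" using am[OF m] by (simp add: a_minus_def)
    have "m = a m" using M.minus_equality[OF 0] m by simp
    then show ?thesis using J(2)[OF a(1) m] by simp
  qed
  then show ?thesis using k(1) by blast
qed

end

section \<open>FI-simplicity of indecomposable injectives inside the hull\<close>

theorem proposition4p11:
  fixes R :: "('r, 'k) ring_scheme" and M Mhat E :: "('r, 'u) module"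
  assumes "infinite (UNIV :: 'u set)"
    and "left_module R M"
    and "progenerator_in_sigma R M"
    and "co_semisimple R M"
    and "Goldie_module R M"
    and "injective_hull_in_sigma R M Mhat"
    and "injective_in_sigma R M E"
    and "indecomposable R E"
    and "embeds_in R E Mhat"
  shows "FI_simple R E"
proof -
  interpret cosemisimple_progenerator R M
    using assms(2-4) by (simp add: cosemisimple_progenerator_def progenerator_module_def
        cosemisimple_progenerator_axioms_def)
  have acc: "ACC_left_annihilators R M" and fud: "finite_uniform_dimension R M"
    using assms(5) by (simp_all add: Goldie_module_def)
  have ES: "E \<in> sigma_cat R M" using assms(7) by (simp add: injective_in_sigma_def)
  then have lE: "left_module R E" by (simp add: sigma_cat_def)
  have lH: "left_module R Mhat"
    using assms(6) by (simp add: injective_hull_in_sigma_def injective_in_sigma_def sigma_cat_def)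
  obtain j where j: "lin R E Mhat j" "inj_on j (carrier E)"
    using assms(9) unfolding embeds_in_def Mono_hom_def Hom_iff_lin by blast
  obtain \<iota> where i: "lin R M Mhat \<iota>" "inj_on \<iota> (carrier M)" "essential_submodule R Mhat (\<iota> ` carrier M)"
    using assms(6) unfolding injective_hull_in_sigma_def Mono_hom_def Hom_iff_lin by blast
  have nsM: "nonsingular_over R M M" by (rule nonsingular[OF acc])
  have nsE: "nonsingular_over R M E" by (rule nonsingular_in_hull[OF lE lH j i nsM])
  show ?thesis
    unfolding FI_simple_def
  proof (intro allI impI)
    fix N assume N: "fully_invariant R E N"
    then have sN: "submodule N R E" by (simp add: fully_invariant_def)
    have "N = carrier E" if "N \<noteq> {\<zero>\<^bsub>E\<^esub>}"
    proof -
      have ess: "essential_submodule R E N"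
        by (rule indecomposable_injective_essential[OF assms(7,8) nsE sN that])
      \<comment> \<open>This carries N over from \<open>E\<close> to \<open>M\<close>, where
        projectivity and co-semisimplicity are available. It is fully invariant because f t is again
        a map M \<rightarrow> E for every endomorphism t.\<close>
      let ?K = "{m \<in> carrier M. \<forall>f. lin R M E f \<longrightarrow> f m \<in> N}"
      have K: "essential_submodule R M ?K"
        by (rule common_preimage_essential[OF assms(7) nsE fud N ess])
      have "fully_invariant R M ?K"
      proof (rule fully_invariantI)
        show "submodule ?K R M" using K by (simp add: essential_submodule_def)
        fix t x assume t: "lin R M M t" and x: "x \<in> ?K"
        then show "t x \<in> ?K" using lin_comp[OF t] lin_closed[OF t] by blast
      qed
      \<comment> \<open>Now every map M \<rightarrow> E takes all its values in N, and
        \<open>E\<close> is generated by the images of such maps.\<close>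
      then have "?K = carrier M" by (rule essential_fully_invariant_eq_carrier[OF nsM fud _ K])
      then show "N = carrier E"
        by (intro generator_trace[OF left_module generator ES sN]) blast
    qed
    then show "N = {\<zero>\<^bsub>E\<^esub>} \<or> N = carrier E" by blast
  qed
qed

end
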